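(* The four-parameter left-invariant metric on the real Jacobi group $G^J_1(\mathbb{R})$ in the S-coordinates $(x,y,\theta,p,q,\kappa)$ is $$ds^2_{G^J_1(\mathbb{R})}=\sum_{i=1}^6\lambda_i^2=\alpha\frac{dx^2+dy^2}{y^2}+\beta\left(\frac{dx}{y}+2d\theta\right)^2+\frac{\gamma}{y}\left[dq^2+(x^2+y^2)dp^2+2x\,dp\,dq\right]+\delta(d\kappa-p\,dq+q\,dp)^2.$$ One has $\langle\lambda_i|L^j\rangle=\delta_{ij}$, $i,j=1,\dots,6$, where the vector fields $L^i$, $i=1,\dots,6$, are orthonormal with respect to this metric and verify the commutation relations $$[L^1,L^2]=-\tfrac{\sqrt\beta}{\alpha}L^3,\quad [L^2,L^3]=\tfrac{1}{2\sqrt\beta}L^1,\quad [L^3,L^1]=\tfrac{1}{\sqrt\beta}L^2,$$ $$[L^1,L^4]=-\tfrac{1}{2\sqrt\alpha}L^5,\quad [L^1,L^5]=-\tfrac{1}{2\sqrt\alpha}L^4,\quad [L^1,L^6]=0,$$ $$[L^2,L^4]=-\tfrac{1}{2\sqrt\alpha}L^4,\quad [L^2,L^5]=\tfrac{1}{2\sqrt\alpha}L^5,\quad [L^2,L^6]=0,$$ $$[L^3,L^4]=-\tfrac{1}{2\sqrt\alpha}L^5,\quad [L^3,L^5]=\tfrac{1}{2\sqrt\beta}L^4,\quad [L^3,L^6]=0,$$ $$[L^4,L^5]=\tfrac{2\sqrt\delta}{\gamma}L^6,\quad [L^4,L^6]=0,\quad [L^5,L^6]=0.$$ If $X=X^1\partial_x+X^2\partial_y+X^3\partial_\theta+X^4\partial_p+X^5\partial_q+X^6\partial_\kappa\in\mathfrak{g}^J_1(\mathbb{R})$,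 then the fundamental vector fields in the S-variables, associated to the generators $F,G,H,P,Q,R$ and corresponding to the left action of the Jacobi group on itself, namely $$F^*=\partial_x-p\,\partial_q,\quad G^*=(y^2-x^2)\partial_x-2xy\,\partial_y-y\,\partial_\theta,\quad H^*=2(x\,\partial_x+y\,\partial_y)-p\,\partial_p+q\,\partial_q,$$ $$P^*=\partial_p+q\,\partial_\kappa,\quad Q^*=\partial_q-p\,\partial_\kappa,\quad R^*=\partial_\kappa,$$ are solutions of the following Killing equations associated to this invariant metric: $$-(\alpha+\beta)X^2+(\alpha+\beta)y\,\partial_xX^1+2\beta y^2\partial_xX^3=0,$$ $$\alpha\,\partial_xX^2+(\alpha+\beta)\partial_yX^1+2\beta y\,\partial_yX^3=0,$$ $$-2\beta X^2+2\beta y\,\partial_xX^1+4\beta y^2\partial_xX^3+(\alpha+\beta)\partial_\theta X^1+2\beta y\,\partial_\theta X^3=0,$$ $$\left(\gamma\tfrac{x^2+y^2}{y}+\delta q^2\right)\partial_xX^4+\left(\gamma\tfrac{x}{y}-\delta pq\right)\partial_xX^5+\delta q\,\partial_xX^6+\tfrac{\alpha+\beta}{y^2}\partial_pX^1+2\tfrac{\beta}{y}\partial_pX^3=0,$$ $$\left(\gamma\tfrac{x}{y}-\delta pq\right)\partial_xX^4+\left(\tfrac{\gamma}{y}+\delta p^2\right)\partial_xX^6-\delta p\,\partial_xX^6+\tfrac{\alpha+\beta}{y^2}\partial_qX^1+2\tfrac{\beta}{y}\partial_qX^3=0,$$ $$\delta q\,\partial_xX^4-\delta p\,\partial_xX^5+\delta\,\partial_xX^6+\tfrac{\alpha+\beta}{y^2}\partial_\kappa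 X^3+2\tfrac{\beta}{y}\partial_\kappa X^3=0,$$ $$-X^2+y\,\partial_yX^2=0,$$ $$2\tfrac{\beta}{y}\partial_yX^1+4\beta\,\partial_yX^3+\tfrac{\alpha}{y^2}\partial_\theta X^2=0,$$ $$\left(\gamma\tfrac{x^2+y^2}{y}+\delta q^2\right)\partial_yX^4+\left(\gamma\tfrac{x}{y}-\delta pq\right)\partial_yX^5+\delta q\,\partial_yX^6+\tfrac{\alpha}{y^2}\partial_pX^2=0,$$ $$\left(\gamma\tfrac{x}{y}-\delta pq\right)\partial_yX^4+\left(\tfrac{\gamma}{y}+\delta p^2\right)\partial_yX^5-\delta p\,\partial_yX^6+\tfrac{\alpha}{y^2}\partial_qX^2=0,$$ $$\delta q\,\partial_yX^4-\delta p\,\partial_yX^5+\delta\,\partial_yX^6+\tfrac{\alpha}{y^2}\partial_\kappa X^2=0,$$ $$\partial_\theta X^1+2y\,\partial_\theta X^3=0,$$ $$\left(\gamma\tfrac{x^2+y^2}{y}+\delta q^2\right)\partial_\theta X^4+\left(\gamma\tfrac{x}{y}-\delta pq\right)\partial_\theta X^5+\delta q\,\partial_\theta X^6+2\tfrac{\beta}{y}\partial_pX^1+4\beta\,\partial_pX^6=0,$$ $$\left(\gamma\tfrac{x}{y}-\delta pq\right)\partial_\theta X^4+\left(\tfrac{\gamma}{y}+\delta p^2\right)\partial_\theta X^5-\delta p\,\partial_\theta X^6+2\tfrac{\beta}{y}\partial_qX^3+4\beta\,\partial_qX^3=0,$$ $$\delta q\,\partial_\theta X^4+\left(\tfrac{\gamma}{y}-\delta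 p\right)\partial_\theta X^5+\delta\,\partial_\theta X^6+4\beta\,\partial_\kappa X^3+2\tfrac{\beta}{y}\partial_\kappa X^1=0,$$ $$2\gamma\tfrac{x}{y}X^1+\gamma\left(1-\tfrac{x^2}{y^2}\right)X^2+2\delta q X^5+2\left(\gamma\tfrac{x^2+y^2}{y}+\delta q^2\right)\partial_pX^4+2\left(\gamma\tfrac{x}{y}-\delta pq\right)\partial_pX^4+2\delta q\,\partial_pX^6=0,$$ $$\tfrac{\gamma}{y}X^1-\gamma\tfrac{x}{y^2}X^2-\delta(qX^4+pX^5)+\left(\gamma\tfrac{x}{y}-\delta pq\right)\partial_pX^4+\left(\tfrac{\gamma}{y}+\delta p^2\right)\partial_pX^5-\delta p\,\partial_pX^6+\left(\gamma\tfrac{x^2+y^2}{y}+\delta q^2\right)\partial_qX^4+\left(\gamma\tfrac{x}{y}-\delta pq\right)\partial_qX^5+\delta q\,\partial_qX^6=0,$$ $$\delta q\,\partial_pX^4-\delta p\,\partial_pX^5+\delta\,\partial_pX^6+\left(\gamma\tfrac{x^2+y^2}{y}+\delta q^2\right)\partial_\kappa X^4+\left(\gamma\tfrac{x}{y}-\delta pq\right)\partial_\kappa X^5+\delta q\,\partial_\kappa X^6=0,$$ $$-\tfrac{\gamma}{y^2}X^2+2\delta pX^4+2\left(\gamma\tfrac{x}{y}-\delta pq\right)\partial_qX^4+2\left(\tfrac{\gamma}{y}+\delta p^2\right)\partial_qX^4-2\delta p\,\partial_qX^6=0,$$ $$-\delta X^4+\delta q\,\partial_qX^4-\delta p\,\partial_qX^5+\delta\,\partial_qX^6+\left(\gamma\tfrac{x}{y}-\delta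 p\kappa\right)\partial_\kappa X^4+\left(\tfrac{\gamma}{y}+\delta p^2\right)\partial_\kappa X^5-\delta p\,\partial_\kappa X^6=0,$$ $$q\,\partial_\kappa X^6-p\,\partial_\kappa X^5+\partial_\kappa X^6=0.$$
   Context: The real Jacobi group $G^J_1(\mathbb{R})=\mathrm{SL}(2,\mathbb{R})\ltimes\mathrm{H}_1$ ($\mathrm{H}_1$ the 3-dimensional Heisenberg group) is realized as the group of matrices $$g=\begin{pmatrix}a&0&b&q\\ \lambda&1&\mu&\kappa\\ c&0&d&-p\\0&0&0&1\end{pmatrix},\quad M=\begin{pmatrix}a&b\\c&d\end{pmatrix}\in\mathrm{SL}(2,\mathbb{R}),\quad (p,q)=(\lambda,\mu)M^{-1},$$ i.e. triples $(M,X,\kappa)$, $X=(\lambda,\mu)\in\mathbb{R}^2$, with composition law $(M,X,\kappa)(M',X',\kappa')=\left(MM',\,XM'+X',\,\kappa+\kappa'+\det\begin{pmatrix}XM'\\ X'\end{pmatrix}\right)$. The S-coordinates of $g$ are $(x,y,\theta,p,q,\kappa)$, where $(x,y,\theta)$, $y>0$, are given by the Iwasawa decomposition $$M=\begin{pmatrix}1&x\\0&1\end{pmatrix}\begin{pmatrix}y^{1/2}&0\\0&y^{-1/2}\end{pmatrix}\begin{pmatrix}\cos\theta&\sin\theta\\-\sin\theta&\cos\theta\end{pmatrix}.$$ Let $E_{ij}$ be the $4\times4$ matrix units. The Lie algebra $\mathfrak{g}^J_1(\mathbb{R})$ of $G^J_1(\mathbb{R})$ has basis $P=E_{21}-E_{34}$,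 $Q=E_{14}+E_{23}$, $R=E_{24}$, $F=E_{13}$, $G=E_{31}$, $H=E_{11}-E_{33}$. Left-invariant one-forms are defined by $g^{-1}dg=\lambda^FF+\lambda^GG+\lambda^HH+\lambda^PP+\lambda^QQ+\lambda^RR$, and $L^F,L^G,L^H,L^P,L^Q,L^R$ are the dual left-invariant vector fields. With positive parameters $\alpha,\beta,\gamma,\delta$ put $\lambda_1=\sqrt\alpha(\lambda^F+\lambda^G)$, $\lambda_2=2\sqrt\alpha\lambda^H$, $\lambda_3=\sqrt\beta(\lambda^F-\lambda^G)$, $\lambda_4=\sqrt\gamma\lambda^P$, $\lambda_5=\sqrt\gamma\lambda^Q$, $\lambda_6=\sqrt\delta\lambda^R$, and $L^1=\frac{1}{2\sqrt\alpha}(L^F+L^G)$, $L^2=\frac{1}{2\sqrt\alpha}L^H$, $L^3=\frac{1}{2\sqrt\beta}(L^F-L^G)$, $L^4=\frac{1}{\sqrt\gamma}L^P$, $L^5=\frac{1}{\sqrt\gamma}L^Q$, $L^6=\frac{1}{\sqrt\delta}L^R$. For $X\in\mathfrak{g}^J_1(\mathbb{R})$ the fundamental vector field of the left action of the group on itself is $X^*_g=\frac{d}{dt}(\exp(tX)\,g)|_{t=0}$. $\langle\cdot|\cdot\rangle$ is the pairing of one-forms and vector fields. A vector field is a Killing vector field of a metric if the Lie derivative of the metric along it vanishes.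
   Formalization: Misprints are corrected: [L²,L³]=L¹/√β, [L³,L⁴]=−L⁵/(2√β), G* gains −q∂_p, the 18th Killing equation gains δX⁵, and wrong indices or coefficients in Killing equations 5, 6, 13–16 and 19–21 are replaced by those of the Lie derivative of the metric. *)

theory Defs
  imports "HOL-Analysis.Analysis"
begin

lemma vector_4 [simp]:
  "(vector [a, b, c, d] :: 'a::zero^4) $ 1 = a"
  "(vector [a, b, c, d] :: 'a::zero^4) $ 2 = b"
  "(vector [a, b, c, d] :: 'a::zero^4) $ 3 = c"
  "(vector [a, b, c, d] :: 'a::zero^4) $ 4 = d"
  unfolding vector_def by simp_all

lemma vector_6 [simp]:
  "(vector [a, b, c, d, e, f] :: 'a::zero^6) $ 1 = a"
  "(vector [a, b, c, d, e, f] :: 'a::zero^6) $ 2 = b"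
  "(vector [a, b, c, d, e, f] :: 'a::zero^6) $ 3 = c"
  "(vector [a, b, c, d, e, f] :: 'a::zero^6) $ 4 = d"
  "(vector [a, b, c, d, e, f] :: 'a::zero^6) $ 5 = e"
  "(vector [a, b, c, d, e, f] :: 'a::zero^6) $ 6 = f"
  unfolding vector_def by simp_all

lemma matrix_inv_eqI:
  assumes "(A :: real^'n^'n) ** B = mat 1"
  shows "matrix_inv A = B"
proof -
  have BA: "B ** A = mat 1" using assms matrix_left_right_inverse by blast
  have "A ** matrix_inv A = mat 1 \<and> matrix_inv A ** A = mat 1"
    unfolding matrix_inv_def by (rule someI[of _ B]) (use assms BA in auto)
  then show ?thesis by (metis BA matrix_mul_assoc matrix_mul_lid matrix_mul_rid)
qed

text \<open>The argument \<^term>\<open>X\<close> is the row vector \<open>(\<lambda>, \<mu>)\<close>.\<close>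

definition jacobi_mat :: "real^2^2 \<Rightarrow> real^2 \<Rightarrow> real \<Rightarrow> real^4^4" where
  "jacobi_mat M X \<kappa> = (let pq = X v* matrix_inv M in
     vector [vector [M$1$1, 0, M$1$2, pq$2],
             vector [X$1,   1, X$2,   \<kappa>],
             vector [M$2$1, 0, M$2$2, - (pq$1)],
             vector [0,     0, 0,     1]])"

definition jacobi_group :: "(real^4^4) set" where
  "jacobi_group = {jacobi_mat M X \<kappa> |M X \<kappa>. det M = 1}"

lemma jacobi_mat_mult:
  assumes "det M = 1" and "det M' = 1"
  shows "jacobi_mat M X \<kappa> ** jacobi_mat M' X' \<kappa>' =
    jacobi_mat (M ** M') (X v* M' + X')
      (\<kappa> + \<kappa>' + det (vector [X v* M', X'] :: real^2^2))"
proof -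
  have inv: "matrix_inv A = vector [vector [A$2$2, - A$1$2], vector [- A$2$1, A$1$1]]"
    if "det A = 1" for A :: "real^2^2"
    using that by (intro matrix_inv_eqI)
      (simp add: vec_eq_iff forall_2 matrix_matrix_mult_def sum_2 mat_def det_2 mult.commute)
  have MM: "det (M ** M') = 1" using assms by (simp add: det_mul)
  show ?thesis
    using assms unfolding jacobi_mat_def Let_def inv[OF MM] inv[OF assms(1)] inv[OF assms(2)] det_2
    apply (simp add: vec_eq_iff forall_4 matrix_matrix_mult_def vector_matrix_mult_def sum_2 sum_4)
    apply (intro conjI)
    subgoal premises p using p(2) by algebra
    subgoal by (simp add: algebra_simps)
    subgoal premises p using p(2) by algebra
    done
qed

definition mat_unit :: "4 \<Rightarrow> 4 \<Rightarrow> real^4^4" where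
  "mat_unit i j = (\<chi> k l. if k = i \<and> l = j then 1 else 0)"

definition gen_P :: "real^4^4" where "gen_P = mat_unit 2 1 - mat_unit 3 4"
definition gen_Q :: "real^4^4" where "gen_Q = mat_unit 1 4 + mat_unit 2 3"
definition gen_R :: "real^4^4" where "gen_R = mat_unit 2 4"
definition gen_F :: "real^4^4" where "gen_F = mat_unit 1 3"
definition gen_G :: "real^4^4" where "gen_G = mat_unit 3 1"
definition gen_H :: "real^4^4" where "gen_H = mat_unit 1 1 - mat_unit 3 3"

definition jacobi_basis :: "(real^4^4) set" where
  "jacobi_basis = {gen_P, gen_Q, gen_R, gen_F, gen_G, gen_H}"

definition jacobi_tangent :: "real^4^4 \<Rightarrow> (real^4^4) set" where
  "jacobi_tangent g = (\<lambda>Z. g ** Z) ` span jacobi_basis"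

text \<open>The library has no exponential for square matrices under \<^term>\<open>(**)\<close>.\<close>

primrec mat_power :: "real^'n^'n \<Rightarrow> nat \<Rightarrow> real^'n^'n" where
  "mat_power A 0 = mat 1"
| "mat_power A (Suc n) = A ** mat_power A n"

definition mat_exp :: "real^'n^'n \<Rightarrow> real^'n^'n" where
  "mat_exp A = (\<Sum>n. (1 / fact n) *\<^sub>R mat_power A n)"

text \<open>\<^term>\<open>left_form Z g A\<close> is the coefficient of the basis element \<^term>\<open>Z\<close> in
  \<open>g\<^sup>-\<^sup>1 dg\<close>, evaluated at a tangent matrix \<^term>\<open>A\<close> at \<^term>\<open>g\<close>.\<close>

definition left_form :: "real^4^4 \<Rightarrow> real^4^4 \<Rightarrow> real^4^4 \<Rightarrow> real" where
  "left_form Z g A = representation jacobi_basis (matrix_inv g ** A) Z"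

definition coframe ::
  "real \<Rightarrow> real \<Rightarrow> real \<Rightarrow> real \<Rightarrow> 6 \<Rightarrow> real^4^4 \<Rightarrow> real^4^4 \<Rightarrow> real" where
  "coframe \<alpha> \<beta> \<gamma> \<delta> i g A =
     (vector [sqrt \<alpha> * (left_form gen_F g A + left_form gen_G g A),
              2 * sqrt \<alpha> * left_form gen_H g A,
              sqrt \<beta> * (left_form gen_F g A - left_form gen_G g A),
              sqrt \<gamma> * left_form gen_P g A,
              sqrt \<gamma> * left_form gen_Q g A,
              sqrt \<delta> * left_form gen_R g A] :: real^6) $ i"

definition jacobi_metric ::
  "real \<Rightarrow> real \<Rightarrow> real \<Rightarrow> real \<Rightarrow> real^4^4 \<Rightarrow> real^4^4 \<Rightarrow> real^4^4 \<Rightarrow> real" where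
  "jacobi_metric \<alpha> \<beta> \<gamma> \<delta> g A B =
     (\<Sum>i\<in>UNIV. coframe \<alpha> \<beta> \<gamma> \<delta> i g A * coframe \<alpha> \<beta> \<gamma> \<delta> i g B)"

definition left_invariant_metric :: "(real^4^4 \<Rightarrow> real^4^4 \<Rightarrow> real^4^4 \<Rightarrow> real) \<Rightarrow> bool" where
  "left_invariant_metric m \<longleftrightarrow>
     (\<forall>g\<in>jacobi_group. \<forall>A\<in>jacobi_tangent g. \<forall>B\<in>jacobi_tangent g.
        m g A B = m g B A \<and>
        (\<forall>C\<in>jacobi_tangent g. \<forall>r. m g (r *\<^sub>R A + C) B = r * m g A B + m g C B) \<and>
        (A \<noteq> 0 \<longrightarrow> m g A A > 0) \<and>
        (\<forall>h\<in>jacobi_group. m (h ** g) (h ** A) (h ** B) = m g A B))"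

text \<open>The coordinates 1 to 6 are \<open>x, y, \<theta>, p, q, \<kappa>\<close>.  The angle \<open>\<theta>\<close> ranges over all reals, so
  \<open>S_param\<close> is a local parametrization of the group, periodic in \<open>\<theta>\<close>.
  Since \<open>(p, q) = (\<lambda>, \<mu>) M\<^sup>-\<^sup>1\<close>, one has \<open>(\<lambda>, \<mu>) = (p, q) M\<close>.\<close>

definition S_domain :: "(real^6) set" where
  "S_domain = {s. s$2 > 0}"

definition iwasawa :: "real \<Rightarrow> real \<Rightarrow> real \<Rightarrow> real^2^2" where
  "iwasawa x y \<theta> =
     (vector [vector [1, x], vector [0, 1]] :: real^2^2) **
     (vector [vector [sqrt y, 0], vector [0, 1 / sqrt y]] :: real^2^2) **
     vector [vector [cos \<theta>, sin \<theta>], vector [- sin \<theta>, cos \<theta>]]"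

definition S_param :: "real^6 \<Rightarrow> real^4^4" where
  "S_param s = (let M = iwasawa (s$1) (s$2) (s$3) in
     jacobi_mat M ((vector [s$4, s$5] :: real^2) v* M) (s$6))"

lemma iwasawa_entries:
  "iwasawa x y \<theta> =
     vector [vector [sqrt y * cos \<theta> - x * sin \<theta> / sqrt y, sqrt y * sin \<theta> + x * cos \<theta> / sqrt y],
             vector [- sin \<theta> / sqrt y, cos \<theta> / sqrt y]]"
  by (simp add: iwasawa_def vec_eq_iff forall_2 matrix_matrix_mult_def sum_2 algebra_simps)

lemma det_iwasawa:
  assumes "y > 0"
  shows "det (iwasawa x y \<theta>) = 1"
proof -
  obtain r where r: "r > 0" "y = r * r" "sqrt (r * r) = r"
    using assms by (metis real_sqrt_gt_0_iff real_sqrt_mult_self abs_of_pos)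
  obtain c t where ct: "cos \<theta> = c" "sin \<theta> = t" by blast
  have "det (iwasawa x y \<theta>) = t * t + c * c"
    unfolding iwasawa_entries det_2 using r by (simp add: field_simps ct)
  also have "\<dots> = 1"
    using sin_cos_squared_add[of \<theta>] by (simp add: ct power2_eq_square)
  finally show ?thesis .
qed

lemma S_param_image: "S_param ` S_domain = jacobi_group"
proof
  show "S_param ` S_domain \<subseteq> jacobi_group" 
    unfolding S_param_def S_domain_def jacobi_group_def Let_def using det_iwasawa by blast
  show "jacobi_group \<subseteq> S_param ` S_domain"
  proof
    fix g assume "g \<in> jacobi_group"
    then obtain M X k where g: "g = jacobi_mat M X k" and d: "det M = 1" unfolding jacobi_group_def by blast
    define n where "n = (M$2$1)^2 + (M$2$2)^2"
    have dd: "M$1$1 * M$2$2 - M$1$2 * M$2$1 = 1" using d by (simp add: det_2)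
    then have "n \<noteq> 0" unfolding n_def by auto
    then have n: "n > 0" unfolding n_def by (smt (verit) sum_power2_gt_zero_iff zero_eq_power2)
    have "(M$2$2/sqrt n)^2 + (- M$2$1/sqrt n)^2 = 1"
    proof -
      have "(M$2$2/sqrt n)^2 + (- M$2$1/sqrt n)^2 = ((M$2$1)^2 + (M$2$2)^2) / n"
        using n by (simp add: power_divide add_divide_distrib)
      then show ?thesis using n unfolding n_def[symmetric] by simp
    qed
    then obtain \<theta> where t: "M$2$2/sqrt n = cos \<theta>" "- M$2$1/sqrt n = sin \<theta>" using sincos_total_2pi by metis
    define x where "x = (M$1$1 * M$2$1 + M$1$2 * M$2$2)/n"
    have sn: "sqrt n * sqrt n = n" using n by simp
    have nn: "n = M$2$1 * M$2$1 + M$2$2 * M$2$2" by (simp add: n_def power2_eq_square)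
    have M: "iwasawa x (1/n) \<theta> = M"
      unfolding iwasawa_entries t[symmetric] real_sqrt_divide real_sqrt_one x_def vec_eq_iff forall_2 vector_2
      using n dd sn apply (simp add: field_simps)
      apply (simp add: nn)
      apply (intro conjI; algebra)
      done
    define pq where "pq = X v* matrix_inv M"
    obtain N where N: "M ** N = mat 1" using d invertible_det_nz[of M] by (auto simp: invertible_def)
    then have "matrix_inv M = N" "N ** M = mat 1" using matrix_inv_eqI[of M N] matrix_left_right_inverse[of M N] by auto
    then have X: "pq v* M = X" unfolding pq_def by (simp add: vector_matrix_mul_assoc)
    have "(vector [pq$1, pq$2] :: real^2) = pq" by (simp add: vec_eq_iff forall_2)
    then have "S_param (vector [x, 1/n, \<theta>, pq$1, pq$2, k]) = g"
      unfolding S_param_def Let_def vector_6 M g using X by simp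
    moreover have "vector [x, 1/n, \<theta>, pq$1, pq$2, k] \<in> S_domain" using n by (simp add: S_domain_def)
    ultimately show "g \<in> S_param ` S_domain" by blast
  qed
qed

definition S_differential :: "real^6 \<Rightarrow> real^6 \<Rightarrow> real^4^4" where
  "S_differential s = frechet_derivative S_param (at s)"

definition S_coframe :: "real \<Rightarrow> real \<Rightarrow> real \<Rightarrow> real \<Rightarrow> 6 \<Rightarrow> real^6 \<Rightarrow> real^6 \<Rightarrow> real" where
  "S_coframe \<alpha> \<beta> \<gamma> \<delta> i s v = coframe \<alpha> \<beta> \<gamma> \<delta> i (S_param s) (S_differential s v)"

definition S_metric :: "real \<Rightarrow> real \<Rightarrow> real \<Rightarrow> real \<Rightarrow> real^6 \<Rightarrow> real^6 \<Rightarrow> real^6 \<Rightarrow> real" where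
  "S_metric \<alpha> \<beta> \<gamma> \<delta> s v w =
     jacobi_metric \<alpha> \<beta> \<gamma> \<delta> (S_param s) (S_differential s v) (S_differential s w)"

text \<open>The S-coordinate components of a vector field on the group, the latter given by its
  tangent matrix at each group element.\<close>

definition S_field :: "(real^4^4 \<Rightarrow> real^4^4) \<Rightarrow> real^6 \<Rightarrow> real^6" where
  "S_field V s = (THE v. S_differential s v = V (S_param s))"

definition left_field :: "real^4^4 \<Rightarrow> real^6 \<Rightarrow> real^6" where
  "left_field Z = S_field (\<lambda>g. g ** Z)"

definition fundamental_field :: "real^4^4 \<Rightarrow> real^6 \<Rightarrow> real^6" where
  "fundamental_field Z = S_field (\<lambda>g. vector_derivative (\<lambda>t. mat_exp (t *\<^sub>R Z) ** g) (at 0))"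

definition frame :: "real \<Rightarrow> real \<Rightarrow> real \<Rightarrow> real \<Rightarrow> 6 \<Rightarrow> real^6 \<Rightarrow> real^6" where
  "frame \<alpha> \<beta> \<gamma> \<delta> i s =
     (vector [(1 / (2 * sqrt \<alpha>)) *\<^sub>R (left_field gen_F s + left_field gen_G s),
              (1 / (2 * sqrt \<alpha>)) *\<^sub>R left_field gen_H s,
              (1 / (2 * sqrt \<beta>)) *\<^sub>R (left_field gen_F s - left_field gen_G s),
              (1 / sqrt \<gamma>) *\<^sub>R left_field gen_P s,
              (1 / sqrt \<gamma>) *\<^sub>R left_field gen_Q s,
              (1 / sqrt \<delta>) *\<^sub>R left_field gen_R s] :: (real^6)^6) $ i"

definition lie_bracket ::
  "('a::real_normed_vector \<Rightarrow> 'a) \<Rightarrow> ('a \<Rightarrow> 'a) \<Rightarrow> 'a \<Rightarrow> 'a" where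
  "lie_bracket X Y s =
     frechet_derivative Y (at s) (X s) - frechet_derivative X (at s) (Y s)"

definition lie_derivative ::
  "('a::real_normed_vector \<Rightarrow> 'a) \<Rightarrow> ('a \<Rightarrow> 'a \<Rightarrow> 'a \<Rightarrow> real) \<Rightarrow>
   ('a \<Rightarrow> 'a) \<Rightarrow> ('a \<Rightarrow> 'a) \<Rightarrow> 'a \<Rightarrow> real" where
  "lie_derivative X m V W s =
     frechet_derivative (\<lambda>u. m u (V u) (W u)) (at s) (X s)
       - m s (lie_bracket X V s) (W s) - m s (V s) (lie_bracket X W s)"

definition killing_field_on ::
  "'a::real_normed_vector set \<Rightarrow> ('a \<Rightarrow> 'a \<Rightarrow> 'a \<Rightarrow> real) \<Rightarrow> ('a \<Rightarrow> 'a) \<Rightarrow> bool" where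
  "killing_field_on S m X \<longleftrightarrow>
     X differentiable_on S \<and>
     (\<forall>V W. V differentiable_on S \<longrightarrow> W differentiable_on S \<longrightarrow>
        (\<forall>s\<in>S. lie_derivative X m V W s = 0))"

definition partial :: "6 \<Rightarrow> (real^6 \<Rightarrow> real) \<Rightarrow> real^6 \<Rightarrow> real" where
  "partial i f s = deriv (\<lambda>t. f (s + t *\<^sub>R axis i 1)) 0"

text \<open>The components of \<open>\<L>\<^bsub>X\<^esub> ds\<^sup>2 = 0\<close>, in the order
  \<open>xx, xy, x\<theta>, xp, xq, x\<kappa>, yy, y\<theta>, \<dots>, \<kappa>\<kappa>\<close>, each cleared of a common factor.\<close>

definition killing_equations ::
  "real \<Rightarrow> real \<Rightarrow> real \<Rightarrow> real \<Rightarrow> (real^6 \<Rightarrow> real^6) \<Rightarrow> real^6 \<Rightarrow> bool" where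
  "killing_equations \<alpha> \<beta> \<gamma> \<delta> X s \<longleftrightarrow>
    (let x = s$1; y = s$2; p = s$4; q = s$5;
         X1 = X s $ 1; X2 = X s $ 2; X4 = X s $ 4; X5 = X s $ 5;
         dx = (\<lambda>k. partial 1 (\<lambda>u. X u $ k) s);
         dy = (\<lambda>k. partial 2 (\<lambda>u. X u $ k) s);
         dth = (\<lambda>k. partial 3 (\<lambda>u. X u $ k) s);
         dp = (\<lambda>k. partial 4 (\<lambda>u. X u $ k) s);
         dq = (\<lambda>k. partial 5 (\<lambda>u. X u $ k) s);
         dk = (\<lambda>k. partial 6 (\<lambda>u. X u $ k) s)
     in
      - (\<alpha> + \<beta>) * X2 + (\<alpha> + \<beta>) * y * dx 1 + 2 * \<beta> * y^2 * dx 3 = 0 \<and>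
      \<alpha> * dx 2 + (\<alpha> + \<beta>) * dy 1 + 2 * \<beta> * y * dy 3 = 0 \<and>
      - 2 * \<beta> * X2 + 2 * \<beta> * y * dx 1 + 4 * \<beta> * y^2 * dx 3
        + (\<alpha> + \<beta>) * dth 1 + 2 * \<beta> * y * dth 3 = 0 \<and>
      (\<gamma> * ((x^2 + y^2) / y) + \<delta> * q^2) * dx 4 + (\<gamma> * (x / y) - \<delta> * p * q) * dx 5
        + \<delta> * q * dx 6 + (\<alpha> + \<beta>) / y^2 * dp 1 + 2 * (\<beta> / y) * dp 3 = 0 \<and>
      (\<gamma> * (x / y) - \<delta> * p * q) * dx 4 + (\<gamma> / y + \<delta> * p^2) * dx 5
        - \<delta> * p * dx 6 + (\<alpha> + \<beta>) / y^2 * dq 1 + 2 * (\<beta> / y) * dq 3 = 0 \<and>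
      \<delta> * q * dx 4 - \<delta> * p * dx 5 + \<delta> * dx 6
        + (\<alpha> + \<beta>) / y^2 * dk 1 + 2 * (\<beta> / y) * dk 3 = 0 \<and>
      - X2 + y * dy 2 = 0 \<and>
      2 * (\<beta> / y) * dy 1 + 4 * \<beta> * dy 3 + \<alpha> / y^2 * dth 2 = 0 \<and>
      (\<gamma> * ((x^2 + y^2) / y) + \<delta> * q^2) * dy 4 + (\<gamma> * (x / y) - \<delta> * p * q) * dy 5
        + \<delta> * q * dy 6 + \<alpha> / y^2 * dp 2 = 0 \<and>
      (\<gamma> * (x / y) - \<delta> * p * q) * dy 4 + (\<gamma> / y + \<delta> * p^2) * dy 5
        - \<delta> * p * dy 6 + \<alpha> / y^2 * dq 2 = 0 \<and>
      \<delta> * q * dy 4 - \<delta> * p * dy 5 + \<delta> * dy 6 + \<alpha> / y^2 * dk 2 = 0 \<and>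
      dth 1 + 2 * y * dth 3 = 0 \<and>
      (\<gamma> * ((x^2 + y^2) / y) + \<delta> * q^2) * dth 4 + (\<gamma> * (x / y) - \<delta> * p * q) * dth 5
        + \<delta> * q * dth 6 + 2 * (\<beta> / y) * dp 1 + 4 * \<beta> * dp 3 = 0 \<and>
      (\<gamma> * (x / y) - \<delta> * p * q) * dth 4 + (\<gamma> / y + \<delta> * p^2) * dth 5
        - \<delta> * p * dth 6 + 2 * (\<beta> / y) * dq 1 + 4 * \<beta> * dq 3 = 0 \<and>
      \<delta> * q * dth 4 - \<delta> * p * dth 5 + \<delta> * dth 6
        + 4 * \<beta> * dk 3 + 2 * (\<beta> / y) * dk 1 = 0 \<and>
      2 * \<gamma> * (x / y) * X1 + \<gamma> * (1 - x^2 / y^2) * X2 + 2 * \<delta> * q * X5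
        + 2 * (\<gamma> * ((x^2 + y^2) / y) + \<delta> * q^2) * dp 4
        + 2 * (\<gamma> * (x / y) - \<delta> * p * q) * dp 5 + 2 * \<delta> * q * dp 6 = 0 \<and>
      \<gamma> / y * X1 - \<gamma> * (x / y^2) * X2 - \<delta> * (q * X4 + p * X5)
        + (\<gamma> * (x / y) - \<delta> * p * q) * dp 4 + (\<gamma> / y + \<delta> * p^2) * dp 5 - \<delta> * p * dp 6
        + (\<gamma> * ((x^2 + y^2) / y) + \<delta> * q^2) * dq 4
        + (\<gamma> * (x / y) - \<delta> * p * q) * dq 5 + \<delta> * q * dq 6 = 0 \<and>
      \<delta> * X5 + \<delta> * q * dp 4 - \<delta> * p * dp 5 + \<delta> * dp 6
        + (\<gamma> * ((x^2 + y^2) / y) + \<delta> * q^2) * dk 4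
        + (\<gamma> * (x / y) - \<delta> * p * q) * dk 5 + \<delta> * q * dk 6 = 0 \<and>
      - (\<gamma> / y^2) * X2 + 2 * \<delta> * p * X4
        + 2 * (\<gamma> * (x / y) - \<delta> * p * q) * dq 4 + 2 * (\<gamma> / y + \<delta> * p^2) * dq 5
        - 2 * \<delta> * p * dq 6 = 0 \<and>
      - \<delta> * X4 + \<delta> * q * dq 4 - \<delta> * p * dq 5 + \<delta> * dq 6
        + (\<gamma> * (x / y) - \<delta> * p * q) * dk 4 + (\<gamma> / y + \<delta> * p^2) * dk 5
        - \<delta> * p * dk 6 = 0 \<and>
      q * dk 4 - p * dk 5 + dk 6 = 0)"

end

theory Submission
  imports Defs
begin

text \<open>
  Differentiating the S-parametrization gives \<open>d S(v) = S \<cdot> \<omega>(v)\<close> with an explicit algebra-valued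
  form \<open>\<omega>\<close> whose value \<open>\<omega>\<^sub>s\<close> at each point of the domain is a linear isomorphism onto the Lie
  algebra.  Solving \<open>\<omega>\<^sub>s(v) = Z\<close> yields the left-invariant fields in S-coordinates, and solving
  \<open>S \<cdot> \<omega>\<^sub>s(v) = Z \<cdot> S\<close> the fundamental ones, each linearly in the coefficients of \<open>Z\<close>, so the bracket
  relations and the Killing equations need to be verified only once, for a general \<open>Z\<close>.

  The Lie derivative of the metric along \<open>X\<close> is tensorial: it depends on the arguments \<open>V, W\<close> only
  through their values at the point, as a symmetric bilinear form in them.  It hence vanishes iff
  its 21 components on the coordinate fields do, and these are multiples, by factors that never
  vanish, of the Killing equations.
\<close>

section \<open>The six-element index type\<close>

lemma exhaust_6: "(x::6) = 1 \<or> x = 2 \<or> x = 3 \<or> x = 4 \<or> x = 5 \<or> x = 6"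
proof (induct x)
  case (of_int z)
  \<comment> \<open>The residues run from 0 to 5, and the index 6 is the residue 0.\<close>
  then have "z = 0 \<or> z = 1 \<or> z = 2 \<or> z = 3 \<or> z = 4 \<or> z = 5" by fastforce
  then show ?case by auto
qed

lemma UNIV_6: "UNIV = {1::6, 2, 3, 4, 5, 6}"
  using exhaust_6 by auto

lemma sum_6: "sum f (UNIV::6 set) = f 1 + f 2 + f 3 + f 4 + f 5 + f 6"
  unfolding UNIV_6 by (simp add: ac_simps)

lemma forall_6: "(\<forall>x::6. P x) \<longleftrightarrow> P 1 \<and> P 2 \<and> P 3 \<and> P 4 \<and> P 5 \<and> P 6"
  by (metis exhaust_6)


section \<open>The Lie algebra and the left-invariant metric\<close>

text \<open>The coordinates are those of F, G, H, P, Q, R, an order that all later definitions keep.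
  The explicit matrix makes products computable entry by entry.\<close>

definition algebra_element :: "real \<Rightarrow> real \<Rightarrow> real \<Rightarrow> real \<Rightarrow> real \<Rightarrow> real \<Rightarrow> real^4^4" where
  "algebra_element f g h a b c =
     vector [vector [h, 0, f, b], vector [a, 0, b, c], vector [g, 0, - h, - a], vector [0, 0, 0, 0]]"

lemma gen_eq_algebra_element:
  "gen_F = algebra_element 1 0 0 0 0 0" "gen_G = algebra_element 0 1 0 0 0 0"
  "gen_H = algebra_element 0 0 1 0 0 0" "gen_P = algebra_element 0 0 0 1 0 0"
  "gen_Q = algebra_element 0 0 0 0 1 0" "gen_R = algebra_element 0 0 0 0 0 1"
  by (simp_all add: gen_F_def gen_G_def gen_H_def gen_P_def gen_Q_def gen_R_def mat_unit_def
      algebra_element_def vec_eq_iff forall_4)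

lemma algebra_element_eq_iff:
  "algebra_element f g h a b c = algebra_element f' g' h' a' b' c' \<longleftrightarrow>
     f = f' \<and> g = g' \<and> h = h' \<and> a = a' \<and> b = b' \<and> c = c'"
  by (auto simp: algebra_element_def vec_eq_iff forall_4)

lemma algebra_element_expansion:
  "algebra_element f g h a b c =
     f *\<^sub>R gen_F + g *\<^sub>R gen_G + h *\<^sub>R gen_H + a *\<^sub>R gen_P + b *\<^sub>R gen_Q + c *\<^sub>R gen_R"
  unfolding gen_eq_algebra_element by (simp add: algebra_element_def vec_eq_iff forall_4)

lemma independent_jacobi_basis: "independent jacobi_basis"
proof (rule independent_if_scalars_zero)
  show "finite jacobi_basis" by (simp add: jacobi_basis_def)
next
  fix r x assume "(\<Sum>x\<in>jacobi_basis. r x *\<^sub>R x) = 0" and x: "x \<in> jacobi_basis"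
  \<comment> \<open>The sum over the set splits into six terms because the generators are pairwise
    distinct.\<close>
  then have "algebra_element (r gen_F) (r gen_G) (r gen_H) (r gen_P) (r gen_Q) (r gen_R) = algebra_element 0 0 0 0 0 0"
    unfolding algebra_element_expansion jacobi_basis_def
    by (simp add: gen_eq_algebra_element algebra_element_eq_iff ac_simps)
  then show "r x = 0" using x unfolding algebra_element_eq_iff jacobi_basis_def by auto
qed

lemma span_jacobi_basis: "span jacobi_basis = {algebra_element f g h a b c | f g h a b c. True}"
proof
  show "span jacobi_basis \<subseteq> {algebra_element f g h a b c | f g h a b c. True}"
  proof (rule span_minimal)
    show "jacobi_basis \<subseteq> {algebra_element f g h a b c | f g h a b c. True}"
      unfolding jacobi_basis_def gen_eq_algebra_element by fast
    have add: "algebra_element f g h a b c + algebra_element f' g' h' a' b' c' =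
        algebra_element (f + f') (g + g') (h + h') (a + a') (b + b') (c + c')"
      and scale: "r *\<^sub>R algebra_element f g h a b c =
        algebra_element (r * f) (r * g) (r * h) (r * a) (r * b) (r * c)"
      and zero: "0 = algebra_element 0 0 0 0 0 0" for r f g h a b c f' g' h' a' b' c'
      by (simp_all add: algebra_element_def vec_eq_iff forall_4)
    show "subspace {algebra_element f g h a b c | f g h a b c. True}" (is "subspace ?S")
    proof (rule subspaceI)
      show "0 \<in> ?S" using zero by blast
      show "x + y \<in> ?S" if "x \<in> ?S" "y \<in> ?S" for x y
        using that unfolding mem_Collect_eq by (metis add)
      show "r *\<^sub>R x \<in> ?S" if "x \<in> ?S" for r x
        using that unfolding mem_Collect_eq by (metis scale)
    qed
  qed
next
  have "algebra_element f g h a b c \<in> span jacobi_basis" for f g h a b c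
    unfolding algebra_element_expansion
    by (intro span_add span_scale span_base) (simp_all add: jacobi_basis_def)
  then show "{algebra_element f g h a b c | f g h a b c. True} \<subseteq> span jacobi_basis" by blast
qed

text \<open>Makes \<open>left_form\<close> computable: the abstract basis coefficients become the
  parameters of the matrix.\<close>

lemma representation_algebra_element:
  fixes f g h a b c :: real
  defines "Z \<equiv> algebra_element f g h a b c"
  shows "representation jacobi_basis Z gen_F = f" "representation jacobi_basis Z gen_G = g"
    "representation jacobi_basis Z gen_H = h" "representation jacobi_basis Z gen_P = a"
    "representation jacobi_basis Z gen_Q = b" "representation jacobi_basis Z gen_R = c"
proof -
  \<comment> \<open>\<open>representation\<close> is a function on all matrices, so the candidate
    has to vanish off the basis.\<close>
  define r where "r = (\<lambda>W. if W = gen_F then f else if W = gen_G then g else if W = gen_H then h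
    else if W = gen_P then a else if W = gen_Q then b else if W = gen_R then c else 0)"
  have d: "distinct [gen_F, gen_G, gen_H, gen_P, gen_Q, gen_R]"
    by (simp add: gen_eq_algebra_element algebra_element_eq_iff)
  then have r: "r gen_F = f" "r gen_G = g" "r gen_H = h" "r gen_P = a" "r gen_Q = b" "r gen_R = c"
    by (auto simp: r_def)
  have "representation jacobi_basis Z = r"
  proof (rule representation_eqI[OF independent_jacobi_basis])
    show "Z \<in> span jacobi_basis" unfolding span_jacobi_basis Z_def by blast
    show W: "W \<in> jacobi_basis" if "r W \<noteq> 0" for W
      using that by (auto simp: r_def jacobi_basis_def split: if_splits)
    then have sub: "{W. r W \<noteq> 0} \<subseteq> jacobi_basis" by blast
    moreover have fin: "finite jacobi_basis" by (simp add: jacobi_basis_def)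
    ultimately show "finite {W. r W \<noteq> 0}" by (rule finite_subset)
    have "(\<Sum>W | r W \<noteq> 0. r W *\<^sub>R W) = (\<Sum>W\<in>jacobi_basis. r W *\<^sub>R W)"
      by (rule sum.mono_neutral_left[OF fin sub]) auto
    also have "\<dots> = Z"
      using d r by (simp add: jacobi_basis_def Z_def algebra_element_expansion not_sym ac_simps)
    finally show "(\<Sum>W | r W \<noteq> 0. r W *\<^sub>R W) = Z" .
  qed
  then show "representation jacobi_basis Z gen_F = f" "representation jacobi_basis Z gen_G = g"
    "representation jacobi_basis Z gen_H = h" "representation jacobi_basis Z gen_P = a"
    "representation jacobi_basis Z gen_Q = b" "representation jacobi_basis Z gen_R = c"
    using r by auto
qed

section \<open>Inverses in the group and left invariance\<close>

lemma jacobi_group_inverse: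
  assumes "g \<in> jacobi_group"
  shows "matrix_inv g ** g = mat 1" "g ** matrix_inv g = mat 1"
proof -
  obtain M X \<kappa> where g: "g = jacobi_mat M X \<kappa>" and M: "det M = 1"
    using assms by (auto simp: jacobi_group_def)
  then obtain N where N: "M ** N = mat 1"
    using invertible_det_nz[of M] by (auto simp: invertible_def)
  have detN: "det N = 1" using arg_cong[OF N, of det] M by (simp add: det_mul)
  have inv1: "matrix_inv (mat 1 :: real^2^2) = mat 1" by (rule matrix_inv_eqI) simp
  \<comment> \<open>The composition law suggests the inverse (M^-1, -X M^-1, -\<kappa>). The
    determinant term then has opposite rows and vanishes.\<close>
  have "g ** jacobi_mat N (- (X v* N)) (- \<kappa>) = jacobi_mat (mat 1) 0 0"
    unfolding g jacobi_mat_mult[OF M detN] N by (simp add: det_2)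
  also have "\<dots> = mat 1"
    by (simp add: jacobi_mat_def inv1 vec_eq_iff forall_4 mat_def)
  finally have *: "g ** jacobi_mat N (- (X v* N)) (- \<kappa>) = mat 1" .
  then have "matrix_inv g = jacobi_mat N (- (X v* N)) (- \<kappa>)" by (rule matrix_inv_eqI)
  with * show "g ** matrix_inv g = mat 1" "matrix_inv g ** g = mat 1"
    using matrix_left_right_inverse by auto
qed

lemma matrix_inv_cancel_left:
  assumes "g \<in> jacobi_group"
  shows "matrix_inv g ** (g ** Z) = Z"
  using assms by (simp add: matrix_mul_assoc jacobi_group_inverse)

text \<open>The left invariance of g^-1 dg, from which that of the coframe and of the metric
  follows.\<close>

lemma matrix_inv_jacobi_mult:
  assumes "g \<in> jacobi_group" "h \<in> jacobi_group"
  shows "matrix_inv (h ** g) ** (h ** A) = matrix_inv g ** A"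
proof -
  have "matrix_inv (h ** g) = matrix_inv g ** matrix_inv h"
    by (intro matrix_inv_eqI)
      (metis assms jacobi_group_inverse(2) matrix_mul_assoc matrix_mul_rid)
  then have "matrix_inv (h ** g) ** (h ** A) = matrix_inv g ** (matrix_inv h ** h ** A)"
    by (simp add: matrix_mul_assoc)
  then show ?thesis by (simp add: jacobi_group_inverse(1)[OF assms(2)])
qed

lemma coframe_left_translate:
  assumes "g \<in> jacobi_group"
  shows "coframe \<alpha> \<beta> \<gamma> \<delta> i g (g ** algebra_element f k h a b c) =
    (vector [sqrt \<alpha> * (f + k), 2 * sqrt \<alpha> * h, sqrt \<beta> * (f - k), sqrt \<gamma> * a, sqrt \<gamma> * b,
       sqrt \<delta> * c] :: real^6) $ i"
  by (simp add: coframe_def left_form_def matrix_inv_cancel_left[OF assms] representation_algebra_element)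

text \<open>Left translation brings the metric to the Lie algebra, where it has constant
  coefficients and is diagonal in the coordinates f + k, h, f - k, a, b, c. Here k is the
  coefficient of G, since g denotes the group element.\<close>

lemma jacobi_metric_left_translate:
  assumes "g \<in> jacobi_group" "\<alpha> \<ge> 0" "\<beta> \<ge> 0" "\<gamma> \<ge> 0" "\<delta> \<ge> 0"
  shows "jacobi_metric \<alpha> \<beta> \<gamma> \<delta> g (g ** algebra_element f k h a b c) (g ** algebra_element f' k' h' a' b' c') =
    \<alpha> * ((f + k) * (f' + k') + 4 * h * h') + \<beta> * ((f - k) * (f' - k'))
      + \<gamma> * (a * a' + b * b') + \<delta> * (c * c')"
proof -
  have sq: "(sqrt r * u) * (sqrt r * w) = r * (u * w)" if "r \<ge> 0" for r u w
    using that by (metis mult.assoc mult.left_commute real_sqrt_mult_self abs_of_nonneg)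
  show ?thesis
    by (simp add: jacobi_metric_def sum_6 coframe_left_translate[OF assms(1)] sq assms(2-) mult.assoc)
      (simp add: sq assms(2-) algebra_simps)
qed

lemma left_invariant_jacobi_metric:
  assumes "\<alpha> > 0" "\<beta> > 0" "\<gamma> > 0" "\<delta> > 0"
  shows "left_invariant_metric (jacobi_metric \<alpha> \<beta> \<gamma> \<delta>)"
  unfolding left_invariant_metric_def
proof (intro ballI conjI allI impI)
  fix g A B assume g: "g \<in> jacobi_group" and A: "A \<in> jacobi_tangent g" and B: "B \<in> jacobi_tangent g"
  let ?m = "jacobi_metric \<alpha> \<beta> \<gamma> \<delta>"
  obtain f k h a b c where A': "A = g ** algebra_element f k h a b c"
    using A unfolding jacobi_tangent_def span_jacobi_basis by blast
  obtain f' k' h' a' b' c' where B': "B = g ** algebra_element f' k' h' a' b' c'"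
    using B unfolding jacobi_tangent_def span_jacobi_basis by blast
  show "?m g A B = ?m g B A" by (simp add: jacobi_metric_def mult.commute)
  show "?m g (r *\<^sub>R A + C) B = r * ?m g A B + ?m g C B" if C: "C \<in> jacobi_tangent g" for C r
  proof -
    obtain f1 k1 h1 a1 b1 c1 where C': "C = g ** algebra_element f1 k1 h1 a1 b1 c1"
      using C unfolding jacobi_tangent_def span_jacobi_basis by blast
    have "r *\<^sub>R A + C = g ** algebra_element (r * f + f1) (r * k + k1) (r * h + h1) (r * a + a1)
        (r * b + b1) (r * c + c1)"
      by (simp add: A' C' algebra_element_def vec_eq_iff forall_4 matrix_matrix_mult_def sum_4
          algebra_simps)
    then show ?thesis
      using assms by (simp add: A' B' C' jacobi_metric_left_translate[OF g] algebra_simps)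
  qed
  show "0 < ?m g A A" if "A \<noteq> 0"
  proof -
    have "algebra_element f k h a b c \<noteq> algebra_element 0 0 0 0 0 0"
      using that unfolding A' by (auto simp: algebra_element_def vec_eq_iff forall_4 matrix_matrix_mult_def sum_4)
    \<comment> \<open>In the coordinates f + k and f - k the quadratic form is a sum of squares with
      positive weights, so one nonzero coordinate suffices.\<close>
    then have "f + k \<noteq> 0 \<or> h \<noteq> 0 \<or> f - k \<noteq> 0 \<or> a \<noteq> 0 \<or> b \<noteq> 0 \<or> c \<noteq> 0"
      by (auto simp: algebra_element_eq_iff)
    moreover have "?m g A A = \<alpha> * (f + k)\<^sup>2 + 4 * \<alpha> * h\<^sup>2 + \<beta> * (f - k)\<^sup>2 + \<gamma> * a\<^sup>2 + \<gamma> * b\<^sup>2 + \<delta> * c\<^sup>2"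
      using assms unfolding A' by (subst jacobi_metric_left_translate[OF g]) (simp_all add: power2_eq_square algebra_simps)
    moreover have "r * x\<^sup>2 \<ge> 0" "x \<noteq> 0 \<Longrightarrow> r * x\<^sup>2 > 0" if "r > 0" for r x :: real using that by simp_all
    ultimately show ?thesis using assms by (smt (verit))
  qed
  show "?m (u ** g) (u ** A) (u ** B) = ?m g A B" if "u \<in> jacobi_group" for u
    by (simp add: jacobi_metric_def coframe_def left_form_def matrix_inv_jacobi_mult[OF g that])
qed

section \<open>The Maurer-Cartan form in S-coordinates\<close>

lemma open_S_domain: "open S_domain"
  unfolding S_domain_def by (intro open_Collect_less continuous_intros)

lemma S_param_in_jacobi_group: "s \<in> S_domain \<Longrightarrow> S_param s \<in> jacobi_group"
  using S_param_image by blast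

lemma has_derivative_vecI:
  fixes f :: "'a::real_normed_vector \<Rightarrow> 'b::euclidean_space^'n"
  assumes "\<And>i. ((\<lambda>x. f x $ i) has_derivative (\<lambda>v. D v $ i)) (at x within A)"
  shows "(f has_derivative D) (at x within A)"
  unfolding has_derivative_componentwise_within[of f] Basis_vec_def
  using assms by (auto simp: inner_axis intro: has_derivative_inner_left)

lemma has_derivative_matrixI:
  fixes f :: "'a::real_normed_vector \<Rightarrow> real^'n^'m"
  assumes "\<And>i j. ((\<lambda>x. f x $ i $ j) has_derivative (\<lambda>v. D v $ i $ j)) (at x within A)"
  shows "(f has_derivative D) (at x within A)"
  by (intro has_derivative_vecI assms)

lemma has_derivative_vec_nth:
  fixes f :: "'a::real_normed_vector \<Rightarrow> 'b::real_normed_vector^'n"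
  assumes "(f has_derivative D) F"
  shows "((\<lambda>x. f x $ i) has_derivative (\<lambda>v. D v $ i)) F"
  by (rule bounded_linear.has_derivative[OF bounded_linear_vec_nth assms])

definition sl2_part :: "real^6 \<Rightarrow> real^2^2" where
  "sl2_part s = iwasawa (s$1) (s$2) (s$3)"

text \<open>The coefficients of \<open>F, G, H, P, Q, R\<close> in the Maurer-Cartan form \<open>g\<^sup>-\<^sup>1 dg\<close>, pulled back to the
  S-coordinates; \<open>s\<close> is the point and \<open>v\<close> the tangent vector.\<close>

definition mc_F :: "real^6 \<Rightarrow> real^6 \<Rightarrow> real" where
  "mc_F s v = (cos (s$3))\<^sup>2 * v$1 / s$2 + cos (s$3) * sin (s$3) * v$2 / s$2 + v$3"
definition mc_G :: "real^6 \<Rightarrow> real^6 \<Rightarrow> real" where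
  "mc_G s v = - ((sin (s$3))\<^sup>2 * v$1 / s$2) + cos (s$3) * sin (s$3) * v$2 / s$2 - v$3"
definition mc_H :: "real^6 \<Rightarrow> real^6 \<Rightarrow> real" where
  "mc_H s v = - (cos (s$3) * sin (s$3) * v$1 / s$2)
     + ((cos (s$3))\<^sup>2 - (sin (s$3))\<^sup>2) * v$2 / (2 * s$2)"
definition mc_P :: "real^6 \<Rightarrow> real^6 \<Rightarrow> real" where
  "mc_P s v = sl2_part s $ 1 $ 1 * v$4 + sl2_part s $ 2 $ 1 * v$5"
definition mc_Q :: "real^6 \<Rightarrow> real^6 \<Rightarrow> real" where
  "mc_Q s v = sl2_part s $ 1 $ 2 * v$4 + sl2_part s $ 2 $ 2 * v$5"
definition mc_R :: "real^6 \<Rightarrow> real^6 \<Rightarrow> real" where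
  "mc_R s v = v$6 - s$4 * v$5 + s$5 * v$4"

definition maurer_cartan :: "real^6 \<Rightarrow> real^6 \<Rightarrow> real^4^4" where
  "maurer_cartan s v =
     algebra_element (mc_F s v) (mc_G s v) (mc_H s v) (mc_P s v) (mc_Q s v) (mc_R s v)"

text \<open>Writing y as a square r * r makes the Iwasawa entries rational in r, which reduces later
  identities to polynomial ones.\<close>

lemma sqrt_param:
  fixes y :: real
  assumes "y > 0"
  obtains r where "r > 0" "y = r * r" "sqrt y = r"
  using assms by (metis real_sqrt_gt_0_iff real_sqrt_mult_self abs_of_pos)

lemma det_sl2_part:
  assumes "s \<in> S_domain"
  shows "sl2_part s $ 1 $ 1 * sl2_part s $ 2 $ 2 - sl2_part s $ 1 $ 2 * sl2_part s $ 2 $ 1 = 1"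
  using det_iwasawa[of "s$2" "s$1" "s$3"] assms by (simp add: S_domain_def sl2_part_def det_2)

text \<open>The SL(2)-factor of the Maurer-Cartan equation: dM = M w, where w is the trace-free
  matrix with rows (H, F) and (G, -H).\<close>

lemma has_derivative_sl2_part:
  assumes "s \<in> S_domain"
  shows "(sl2_part has_derivative
    (\<lambda>v. sl2_part s ** vector [vector [mc_H s v, mc_F s v], vector [mc_G s v, - mc_H s v]])) (at s)"
proof (rule has_derivative_matrixI)
  have y: "s$2 > 0" using assms by (simp add: S_domain_def)
  then obtain r where r: "r > 0" "s$2 = r * r" "sqrt (s$2) = r" by (rule sqrt_param)
  define C D where "C = cos (s$3)" and "D = sin (s$3)"
  \<comment> \<open>\<open>algebra\<close> has no division, so denominators become variables with a defining equation.\<close>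
  define h :: real where "h = inverse 2"
  have h: "2 * h = 1" by (simp add: h_def)
  define k where "k = inverse r"
  have rk: "r * k = 1" using r(1) by (simp add: k_def)
  have cs: "D * D = 1 - C * C"
    by (simp add: C_def D_def power2_eq_square[symmetric] sin_squared_eq)
  note nth = has_derivative_vec_nth[OF has_derivative_ident[where 'a = "real^6"]]
  have dr: "((\<lambda>s::real^6. sqrt (s$2)) has_derivative (\<lambda>v. v$2 / (2 * r))) (at s)"
    by (rule has_derivative_eq_rhs, rule has_derivative_real_sqrt[OF y nth]) (auto simp: r(3) field_simps)
  have dC: "((\<lambda>s::real^6. cos (s$3)) has_derivative (\<lambda>v. - D * v$3)) (at s)"
    by (rule has_derivative_eq_rhs, rule has_derivative_cos[OF nth]) (auto simp: D_def)
  have dD: "((\<lambda>s::real^6. sin (s$3)) has_derivative (\<lambda>v. C * v$3)) (at s)"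
    by (rule has_derivative_eq_rhs, rule has_derivative_sin[OF nth]) (auto simp: C_def)
  have r0: "sqrt (s$2) \<noteq> 0" using r by simp
  note rules = dr dC dD nth has_derivative_add has_derivative_diff has_derivative_mult
    has_derivative_divide' r0 has_derivative_minus
  let ?w = "\<lambda>v. vector [vector [mc_H s v, mc_F s v], vector [mc_G s v, - mc_H s v]] :: real^2^2"
  note simps = matrix_matrix_mult_def sum_2 mc_F_def mc_G_def mc_H_def C_def[symmetric] D_def[symmetric] r(3)
  have "\<forall>i j. ((\<lambda>s. sl2_part s $ i $ j) has_derivative (\<lambda>v. (sl2_part s ** ?w v) $ i $ j)) (at s)"
    unfolding forall_2 sl2_part_def iwasawa_entries vector_2
    by (intro conjI; rule has_derivative_eq_rhs, (rule rules)+, rule ext, simp add: simps,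
        simp only: r(2) divide_inverse inverse_mult_distrib k_def[symmetric] h_def[symmetric]
          power2_eq_square,
        use rk cs h in algebra)
  then show "((\<lambda>s. sl2_part s $ i $ j) has_derivative (\<lambda>v. (sl2_part s ** ?w v) $ i $ j)) (at s)" for i j
    by blast
qed

text \<open>Since \<open>(p, q) = (\<lambda>, \<mu>) M\<^sup>-\<^sup>1\<close> are themselves coordinates, \<open>S_param\<close> involves no inverse matrix.\<close>

definition S_matrix :: "real^6 \<Rightarrow> real^4^4" where
  "S_matrix s = (let M = sl2_part s; p = s$4; q = s$5 in
     vector [vector [M$1$1, 0, M$1$2, q],
             vector [p * M$1$1 + q * M$2$1, 1, p * M$1$2 + q * M$2$2, s$6],
             vector [M$2$1, 0, M$2$2, - p],
             vector [0, 0, 0, 1]])"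

lemma S_param_eq_S_matrix:
  assumes "s \<in> S_domain"
  shows "S_param s = S_matrix s"
proof -
  have "det (sl2_part s) = 1" using assms det_iwasawa by (simp add: sl2_part_def S_domain_def)
  then obtain N where N: "sl2_part s ** N = mat 1"
    using invertible_det_nz[of "sl2_part s"] by (auto simp: invertible_def)
  \<comment> \<open>The inverse matrix in \<open>jacobi_mat\<close> undoes the multiplication by M
    in \<open>S_param\<close>, which leaves (p, q).\<close>
  have *: "u v* sl2_part s v* matrix_inv (sl2_part s) = u" for u
    unfolding vector_matrix_mul_assoc matrix_inv_eqI[OF N] N by simp
  show ?thesis
    unfolding S_param_def jacobi_mat_def Let_def sl2_part_def[symmetric] * S_matrix_def
    by (simp add: vector_matrix_mult_def sum_2 algebra_simps)
qed

text \<open>The equation dS = S \<omega> is checked entrywise. The first three columns come from dM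
  = M w; in the last one M meets \<open>mc_P\<close> and \<open>mc_Q\<close>, and det M = 1 isolates
  dp, dq and d\<kappa>.\<close>

lemma has_derivative_S_matrix:
  assumes "s \<in> S_domain"
  shows "(S_matrix has_derivative (\<lambda>v. S_matrix s ** maurer_cartan s v)) (at s)"
proof (rule has_derivative_matrixI)
  have det: "sl2_part s $ 1 $ 1 * sl2_part s $ 2 $ 2 = 1 + sl2_part s $ 1 $ 2 * sl2_part s $ 2 $ 1"
    using det_sl2_part[OF assms] by simp
  note rules = has_derivative_add has_derivative_diff has_derivative_mult has_derivative_minus
    has_derivative_const has_derivative_vec_nth[OF has_derivative_vec_nth[OF has_derivative_sl2_part[OF assms]]]
    has_derivative_vec_nth[OF has_derivative_ident[where 'a = "real^6"]]
  let ?D = "\<lambda>v. S_matrix s ** maurer_cartan s v"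
  have "\<forall>i j. ((\<lambda>s. S_matrix s $ i $ j) has_derivative (\<lambda>v. ?D v $ i $ j)) (at s)"
    unfolding S_matrix_def Let_def
    apply (simp only: forall_4 vector_4)
    apply (intro conjI; rule has_derivative_eq_rhs, (rule rules)+, rule ext)
    apply (simp_all add: matrix_matrix_mult_def sum_4 sum_2 maurer_cartan_def algebra_element_def
        mc_P_def mc_Q_def mc_R_def)
    apply (simp_all add: algebra_simps)
    apply (use det in algebra)+
    done
  then show "((\<lambda>s. S_matrix s $ i $ j) has_derivative (\<lambda>v. ?D v $ i $ j)) (at s)" for i j
    by blast
qed

lemma has_derivative_S_param:
  assumes "s \<in> S_domain"
  shows "(S_param has_derivative (\<lambda>v. S_param s ** maurer_cartan s v)) (at s)"
  unfolding S_param_eq_S_matrix[OF assms]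
  \<comment> \<open>The two maps are known to agree on the domain, which is open, so their
    derivatives agree there.\<close>
  by (rule has_derivative_transform_within_open[OF has_derivative_S_matrix[OF assms] open_S_domain assms])
    (simp add: S_param_eq_S_matrix)

lemma S_differential_eq:
  assumes "s \<in> S_domain"
  shows "S_differential s v = S_param s ** maurer_cartan s v"
  using frechet_derivative_at[OF has_derivative_S_param[OF assms]] by (simp add: S_differential_def fun_eq_iff)

section \<open>Left-invariant vector fields\<close>

text \<open>The solution \<open>v\<close> of \<^term>\<open>maurer_cartan s v = algebra_element f g h a b c\<close>.\<close>

definition left_vec ::
  "real \<Rightarrow> real \<Rightarrow> real \<Rightarrow> real \<Rightarrow> real \<Rightarrow> real \<Rightarrow> real^6 \<Rightarrow> real^6" where
  "left_vec f g h a b c s =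
    (let M = sl2_part s;
         u = cos (2 * s$3) * (f + g) - 2 * sin (2 * s$3) * h;
         w = sin (2 * s$3) * (f + g) + 2 * cos (2 * s$3) * h;
         v4 = a * M$2$2 - b * M$2$1;
         v5 = b * M$1$1 - a * M$1$2
     in vector [s$2 * u, s$2 * w, (f - g - u) / 2, v4, v5, c + s$4 * v5 - s$5 * v4])"

text \<open>One half of the bijectivity of \<omega> at s: \<open>left_vec\<close> is a right
  inverse, so every algebra element is attained.\<close>

lemma mc_left_vec:
  fixes f g h a b c :: real
  assumes "s \<in> S_domain"
  defines "v \<equiv> left_vec f g h a b c s"
  shows "mc_F s v = f" "mc_G s v = g" "mc_H s v = h" "mc_P s v = a" "mc_Q s v = b" "mc_R s v = c"
proof -
  have det: "sl2_part s $ 1 $ 1 * sl2_part s $ 2 $ 2 = 1 + sl2_part s $ 1 $ 2 * sl2_part s $ 2 $ 1"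
    using det_sl2_part[OF assms(1)] by simp
  have y: "s$2 > 0" using assms by (simp add: S_domain_def)
  show "mc_P s v = a" "mc_Q s v = b" "mc_R s v = c"
    using det
    by (simp_all add: v_def left_vec_def mc_P_def mc_Q_def mc_R_def Let_def algebra_simps)
  define hh :: real where hh: "hh = inverse 2"
  have h2: "2 * hh = 1" by (simp add: hh)
  obtain C D where C: "C = cos (s$3)" and D: "D = sin (s$3)" by blast
  have DD: "D\<^sup>2 + C\<^sup>2 = 1" by (simp add: C D)
  have "2 * mc_F s v = 2 * f" "2 * mc_G s v = 2 * g" "2 * mc_H s v = 2 * h"
    using y unfolding v_def left_vec_def mc_F_def mc_G_def mc_H_def Let_def vector_6 cos_double
      sin_double C[symmetric] D[symmetric]
    apply simp_all
    apply (simp_all only: divide_inverse hh[symmetric])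
    using DD h2 by algebra+
  then show "mc_F s v = f" "mc_G s v = g" "mc_H s v = h" by simp_all
qed

text \<open>The other half: \<open>left_vec\<close> is a left inverse, so a tangent vector is
  determined by its Maurer-Cartan coefficients.\<close>

lemma left_vec_mc:
  assumes "s \<in> S_domain"
  shows "left_vec (mc_F s v) (mc_G s v) (mc_H s v) (mc_P s v) (mc_Q s v) (mc_R s v) s = v"
proof -
  have det: "sl2_part s $ 1 $ 1 * sl2_part s $ 2 $ 2 = 1 + sl2_part s $ 1 $ 2 * sl2_part s $ 2 $ 1"
    using det_sl2_part[OF assms(1)] by simp
  define hh :: real where hh: "hh = inverse 2"
  have h2: "2 * hh = 1" by (simp add: hh)
  obtain C D where C: "C = cos (s$3)" and D: "D = sin (s$3)" by blast
  have DD: "D\<^sup>2 + C\<^sup>2 = 1" by (simp add: C D)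
  \<comment> \<open>Scaling the first two components by y cancels the denominators of the
    Maurer-Cartan form.\<close>
  obtain u w where uw: "v$1 = s$2 * u" "v$2 = s$2 * w" "s$2 \<noteq> 0"
    using assms unfolding S_domain_def
    by (metis less_irrefl mem_Collect_eq nonzero_mult_div_cancel_left times_divide_eq_right)
  show ?thesis
    unfolding vec_eq_iff forall_6 left_vec_def mc_F_def mc_G_def mc_H_def mc_P_def mc_Q_def
      mc_R_def Let_def vector_6 cos_double sin_double C[symmetric] D[symmetric] uw(1,2)
    using uw(3) apply (simp del: uminus_add_conv_diff)
    apply (simp_all only: divide_inverse hh[symmetric])
    apply (intro conjI)
    using DD h2 det by algebra+
qed

lemma left_vec_linear:
  "left_vec f g h a b c s + left_vec f' g' h' a' b' c' s =
     left_vec (f + f') (g + g') (h + h') (a + a') (b + b') (c + c') s"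
  "left_vec f g h a b c s - left_vec f' g' h' a' b' c' s =
     left_vec (f - f') (g - g') (h - h') (a - a') (b - b') (c - c') s"
  "r *\<^sub>R left_vec f g h a b c s = left_vec (r * f) (r * g) (r * h) (r * a) (r * b) (r * c) s"
  by (simp_all add: left_vec_def Let_def vec_eq_iff forall_6 field_simps)

lemma maurer_cartan_left_vec:
  "s \<in> S_domain \<Longrightarrow> maurer_cartan s (left_vec f g h a b c s) = algebra_element f g h a b c"
  by (simp add: maurer_cartan_def mc_left_vec)

text \<open>The definite description in \<open>S_field\<close> requires uniqueness: the group
  element cancels because it is invertible, and \<omega> is injective by
  \<open>left_vec_mc\<close>.\<close>

lemma S_field_eqI:
  assumes s: "s \<in> S_domain" and V: "V (S_param s) = S_param s ** maurer_cartan s v"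
  shows "S_field V s = v"
  unfolding S_field_def
proof (rule the_equality)
  show "S_differential s v = V (S_param s)" using S_differential_eq[OF s] V by simp
  fix w assume "S_differential s w = V (S_param s)"
  then have "S_param s ** maurer_cartan s w = S_param s ** maurer_cartan s v"
    using S_differential_eq[OF s] V by simp
  then have "maurer_cartan s w = maurer_cartan s v"
    by (metis matrix_inv_cancel_left[OF S_param_in_jacobi_group[OF s]])
  then show "w = v"
    unfolding maurer_cartan_def algebra_element_eq_iff by (metis left_vec_mc[OF s])
qed

lemma left_field_eq:
  assumes "s \<in> S_domain"
  shows "left_field (algebra_element f g h a b c) s = left_vec f g h a b c s"
  unfolding left_field_def using assms by (intro S_field_eqI) (simp_all add: maurer_cartan_left_vec)

lemma frame_eq_left_vec:
  fixes \<alpha> \<beta> \<gamma> \<delta> :: real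
  assumes "s \<in> S_domain"
  defines "k \<equiv> 1 / (2 * sqrt \<alpha>)" and "l \<equiv> 1 / (2 * sqrt \<beta>)"
  shows "frame \<alpha> \<beta> \<gamma> \<delta> 1 s = left_vec k k 0 0 0 0 s"
    "frame \<alpha> \<beta> \<gamma> \<delta> 2 s = left_vec 0 0 k 0 0 0 s"
    "frame \<alpha> \<beta> \<gamma> \<delta> 3 s = left_vec l (- l) 0 0 0 0 s"
    "frame \<alpha> \<beta> \<gamma> \<delta> 4 s = left_vec 0 0 0 (1 / sqrt \<gamma>) 0 0 s"
    "frame \<alpha> \<beta> \<gamma> \<delta> 5 s = left_vec 0 0 0 0 (1 / sqrt \<gamma>) 0 s"
    "frame \<alpha> \<beta> \<gamma> \<delta> 6 s = left_vec 0 0 0 0 0 (1 / sqrt \<delta>) s"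
  by (simp_all add: frame_def gen_eq_algebra_element left_field_eq[OF assms(1)] left_vec_linear k_def l_def)

section \<open>Duality, orthonormality and the line element\<close>

lemma S_coframe_eq:
  assumes "s \<in> S_domain"
  shows "S_coframe \<alpha> \<beta> \<gamma> \<delta> i s v =
    (vector [sqrt \<alpha> * (mc_F s v + mc_G s v), 2 * sqrt \<alpha> * mc_H s v, sqrt \<beta> * (mc_F s v - mc_G s v),
       sqrt \<gamma> * mc_P s v, sqrt \<gamma> * mc_Q s v, sqrt \<delta> * mc_R s v] :: real^6) $ i"
  unfolding S_coframe_def S_differential_eq[OF assms] maurer_cartan_def
  by (rule coframe_left_translate[OF S_param_in_jacobi_group[OF assms]])

lemma S_metric_eq_sum:
  "S_metric \<alpha> \<beta> \<gamma> \<delta> s v w = (\<Sum>i\<in>UNIV. S_coframe \<alpha> \<beta> \<gamma> \<delta> i s v * S_coframe \<alpha> \<beta> \<gamma> \<delta> i s w)"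
  by (simp add: S_metric_def jacobi_metric_def S_coframe_def)

lemma S_coframe_frame:
  assumes "\<alpha> > 0" "\<beta> > 0" "\<gamma> > 0" "\<delta> > 0" "s \<in> S_domain"
  shows "S_coframe \<alpha> \<beta> \<gamma> \<delta> i s (frame \<alpha> \<beta> \<gamma> \<delta> j s) = (if i = j then 1 else 0)"
proof -
  have "\<forall>i j. S_coframe \<alpha> \<beta> \<gamma> \<delta> i s (frame \<alpha> \<beta> \<gamma> \<delta> j s) = (if i = j then 1 else 0)"
    unfolding forall_6 using assms
    by (simp add: S_coframe_eq[OF assms(5)] frame_eq_left_vec[OF assms(5)] mc_left_vec[OF assms(5)])
  then show ?thesis by blast
qed

text \<open>Orthonormality follows from duality, because the metric is the sum of the squared
  coframe forms.\<close>

lemma S_metric_frame: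
  assumes "\<alpha> > 0" "\<beta> > 0" "\<gamma> > 0" "\<delta> > 0" "s \<in> S_domain"
  shows "S_metric \<alpha> \<beta> \<gamma> \<delta> s (frame \<alpha> \<beta> \<gamma> \<delta> i s) (frame \<alpha> \<beta> \<gamma> \<delta> j s) = (if i = j then 1 else 0)"
  unfolding S_metric_eq_sum S_coframe_frame[OF assms]
  by (auto intro!: sum.neutral simp: if_distrib[of "\<lambda>x. x * _"] cong: if_cong)

text \<open>The polarization of the line element; the Lie derivative needs the bilinear form and not
  only its diagonal.\<close>

definition S_form :: "real \<Rightarrow> real \<Rightarrow> real \<Rightarrow> real \<Rightarrow> real^6 \<Rightarrow> real^6 \<Rightarrow> real^6 \<Rightarrow> real" where
  "S_form \<alpha> \<beta> \<gamma> \<delta> s v w =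
     \<alpha> * ((v$1 * w$1 + v$2 * w$2) / (s$2)\<^sup>2)
       + \<beta> * ((v$1 / s$2 + 2 * v$3) * (w$1 / s$2 + 2 * w$3))
       + \<gamma> / s$2 * (v$5 * w$5 + ((s$1)\<^sup>2 + (s$2)\<^sup>2) * (v$4 * w$4) + s$1 * (v$4 * w$5 + v$5 * w$4))
       + \<delta> * ((v$6 - s$4 * v$5 + s$5 * v$4) * (w$6 - s$4 * w$5 + s$5 * w$4))"

text \<open>These are the entries of M times its transpose. The rotation factor cancels, so the
  angle disappears from the dp, dq part of the metric.\<close>

lemma sl2_part_mult_transpose:
  assumes "s \<in> S_domain"
  shows "(sl2_part s $ 1 $ 1)\<^sup>2 + (sl2_part s $ 1 $ 2)\<^sup>2 = ((s$1)\<^sup>2 + (s$2)\<^sup>2) / s$2"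
    "sl2_part s $ 1 $ 1 * sl2_part s $ 2 $ 1 + sl2_part s $ 1 $ 2 * sl2_part s $ 2 $ 2 = s$1 / s$2"
    "(sl2_part s $ 2 $ 1)\<^sup>2 + (sl2_part s $ 2 $ 2)\<^sup>2 = 1 / s$2"
proof -
  have "s$2 > 0" using assms by (simp add: S_domain_def)
  then obtain r where r: "r > 0" "s$2 = r * r" "sqrt (s$2) = r" by (rule sqrt_param)
  define k where "k = inverse r"
  have rk: "r * k = 1" using r(1) by (simp add: k_def)
  define C D where "C = cos (s$3)" and "D = sin (s$3)"
  have cs: "D * D = 1 - C * C"
    by (simp add: C_def D_def power2_eq_square[symmetric] sin_squared_eq)
  show "(sl2_part s $ 1 $ 1)\<^sup>2 + (sl2_part s $ 1 $ 2)\<^sup>2 = ((s$1)\<^sup>2 + (s$2)\<^sup>2) / s$2"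
    "sl2_part s $ 1 $ 1 * sl2_part s $ 2 $ 1 + sl2_part s $ 1 $ 2 * sl2_part s $ 2 $ 2 = s$1 / s$2"
    "(sl2_part s $ 2 $ 1)\<^sup>2 + (sl2_part s $ 2 $ 2)\<^sup>2 = 1 / s$2"
    unfolding sl2_part_def iwasawa_entries vector_2 r(3) C_def[symmetric] D_def[symmetric]
    unfolding r(2) divide_inverse inverse_mult_distrib k_def[symmetric]
    using rk cs by algebra+
qed

lemma S_metric_eq_S_form:
  assumes "\<alpha> \<ge> 0" "\<beta> \<ge> 0" "\<gamma> \<ge> 0" "\<delta> \<ge> 0" and s: "s \<in> S_domain"
  shows "S_metric \<alpha> \<beta> \<gamma> \<delta> s v w = S_form \<alpha> \<beta> \<gamma> \<delta> s v w"
proof -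
  define C D where "C = cos (s$3)" and "D = sin (s$3)"
  have cs: "D\<^sup>2 = 1 - C\<^sup>2"
    by (simp add: C_def D_def sin_squared_eq)
  define k where "k = inverse (s$2)"
  define h :: real where "h = inverse 2"
  have h: "2 * h = 1" by (simp add: h_def)
  note T = sl2_part_mult_transpose[OF s]
  \<comment> \<open>The pair (F + G, 2 H) is (dx, dy) / y rotated through twice the angle, and a
    rotation preserves inner products.\<close>
  have AB: "(mc_F s v + mc_G s v) * (mc_F s w + mc_G s w) + 4 * mc_H s v * mc_H s w =
      (v$1 * w$1 + v$2 * w$2) / (s$2)\<^sup>2"
    unfolding mc_F_def mc_G_def mc_H_def C_def[symmetric] D_def[symmetric] divide_inverse power_inverse[symmetric]
      inverse_mult_distrib k_def[symmetric] h_def[symmetric]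
    using cs h by algebra
  have FG: "mc_F s u - mc_G s u = u$1 / s$2 + 2 * u$3" for u
    unfolding mc_F_def mc_G_def C_def[symmetric] D_def[symmetric] divide_inverse k_def[symmetric]
    using cs by algebra
  have PQ: "mc_P s v * mc_P s w + mc_Q s v * mc_Q s w =
      1 / s$2 * (v$5 * w$5) + ((s$1)\<^sup>2 + (s$2)\<^sup>2) / s$2 * (v$4 * w$4) + s$1 / s$2 * (v$4 * w$5 + v$5 * w$4)"
    unfolding T[symmetric] mc_P_def mc_Q_def by algebra
  show ?thesis
    unfolding S_metric_def S_differential_eq[OF s] maurer_cartan_def S_form_def
      jacobi_metric_left_translate[OF S_param_in_jacobi_group[OF s] assms(1-4)] AB FG PQ mc_R_def
    by (simp add: distrib_left)
qed

section \<open>Brackets of left-invariant fields\<close>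

lemma lie_bracketI:
  assumes "(X has_derivative X') (at s)" "(Y has_derivative Y') (at s)"
  shows "lie_bracket X Y s = Y' (X s) - X' (Y s)"
  using assms frechet_derivative_at by (metis lie_bracket_def)

text \<open>Along the angle, u and w have the derivatives -2 w and 2 u, so no further trigonometric
  terms arise; dM is the derivative of the SL(2)-part.\<close>

lemma has_derivative_left_vec:
  fixes f g h a b c :: real
  assumes s: "s \<in> S_domain"
  defines "u \<equiv> cos (2 * s$3) * (f + g) - 2 * sin (2 * s$3) * h"
    and "w \<equiv> sin (2 * s$3) * (f + g) + 2 * cos (2 * s$3) * h"
    and "dM \<equiv> \<lambda>v. sl2_part s ** vector [vector [mc_H s v, mc_F s v], vector [mc_G s v, - mc_H s v]] :: real^2^2"
    and "p4 \<equiv> a * sl2_part s $ 2 $ 2 - b * sl2_part s $ 2 $ 1"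
    and "p5 \<equiv> b * sl2_part s $ 1 $ 1 - a * sl2_part s $ 1 $ 2"
  shows "(left_vec f g h a b c has_derivative
    (\<lambda>v. vector [v$2 * u - 2 * (s$2 * w * v$3), v$2 * w + 2 * (s$2 * u * v$3), w * v$3,
       a * dM v $ 2 $ 2 - b * dM v $ 2 $ 1, b * dM v $ 1 $ 1 - a * dM v $ 1 $ 2,
       v$4 * p5 + s$4 * (b * dM v $ 1 $ 1 - a * dM v $ 1 $ 2)
         - v$5 * p4 - s$5 * (a * dM v $ 2 $ 2 - b * dM v $ 2 $ 1)])) (at s)"
    (is "(_ has_derivative ?D) _")
proof (rule has_derivative_vecI)
  note nth = has_derivative_vec_nth[OF has_derivative_ident[where 'a = "real^6"]]
  have dC: "((\<lambda>s::real^6. cos (2 * s$3)) has_derivative (\<lambda>v. - 2 * sin (2 * s$3) * v$3)) (at s)"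
    by (rule has_derivative_eq_rhs,
        rule has_derivative_cos[OF has_derivative_mult[OF has_derivative_const nth]]) auto
  have dD: "((\<lambda>s::real^6. sin (2 * s$3)) has_derivative (\<lambda>v. 2 * cos (2 * s$3) * v$3)) (at s)"
    by (rule has_derivative_eq_rhs,
        rule has_derivative_sin[OF has_derivative_mult[OF has_derivative_const nth]]) auto
  have two: "(2::real) \<noteq> 0" by simp
  note rules = dC dD has_derivative_add has_derivative_diff has_derivative_mult
    has_derivative_divide' two has_derivative_const
    has_derivative_vec_nth[OF has_derivative_vec_nth[OF has_derivative_sl2_part[OF s]]] nth
  have "\<forall>i. ((\<lambda>s. left_vec f g h a b c s $ i) has_derivative (\<lambda>v. ?D v $ i)) (at s)"
    unfolding left_vec_def Let_def forall_6 vector_6 u_def w_def dM_def p4_def p5_def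
    by (intro conjI; rule has_derivative_eq_rhs, (rule rules)+, simp add: fun_eq_iff field_simps)
  then show "((\<lambda>s. left_vec f g h a b c s $ i) has_derivative (\<lambda>v. ?D v $ i)) (at s)" for i
    by blast
qed

text \<open>The new coefficients are those of the matrix commutator of the two algebra elements:
  passing to left-invariant fields preserves brackets.\<close>

lemma lie_bracket_left_vec:
  assumes s: "s \<in> S_domain"
  shows "lie_bracket (left_vec f g h a b c) (left_vec f' g' h' a' b' c') s =
    left_vec (2 * (h * f' - f * h')) (2 * (g * h' - h * g')) (f * g' - g * f')
      (b * g' - g * b' + a * h' - h * a') (a * f' - f * a' + h * b' - b * h') (2 * (a * b' - b * a')) s"
proof -
  have det: "sl2_part s $ 1 $ 1 * sl2_part s $ 2 $ 2 = 1 + sl2_part s $ 1 $ 2 * sl2_part s $ 2 $ 1"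
    using det_sl2_part[OF s] by simp
  have cs: "(sin (2 * s$3))\<^sup>2 = 1 - (cos (2 * s$3))\<^sup>2" by (simp add: sin_squared_eq)
  show ?thesis
    \<comment> \<open>The Maurer-Cartan coefficients are constant along a left-invariant field, so M
      changes there by M times a constant matrix.\<close>
    unfolding lie_bracketI[OF has_derivative_left_vec[OF s] has_derivative_left_vec[OF s]]
      mc_left_vec[OF s] matrix_matrix_mult_def sum_2
    unfolding left_vec_def Let_def vec_eq_iff forall_6 vector_minus_component vector_6
    apply simp
    apply (intro conjI)
    apply (use det cs in algebra)+
    done
qed

text \<open>The frame fields are identified with \<open>left_vec\<close> on the domain; openness
  carries this identification over to derivatives.\<close>

lemma lie_bracket_eq_left_vec:
  assumes s: "s \<in> S_domain"
    and X: "\<And>u. u \<in> S_domain \<Longrightarrow> X u = left_vec f g h a b c u"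
    and Y: "\<And>u. u \<in> S_domain \<Longrightarrow> Y u = left_vec f' g' h' a' b' c' u"
  shows "lie_bracket X Y s =
    left_vec (2 * (h * f' - f * h')) (2 * (g * h' - h * g')) (f * g' - g * f')
      (b * g' - g * b' + a * h' - h * a') (a * f' - f * a' + h * b' - b * h') (2 * (a * b' - b * a')) s"
proof -
  note L = has_derivative_left_vec[OF s]
  note LX = has_derivative_transform_within_open[OF L open_S_domain s X[symmetric]]
  note LY = has_derivative_transform_within_open[OF L open_S_domain s Y[symmetric]]
  have "lie_bracket X Y s = lie_bracket (left_vec f g h a b c) (left_vec f' g' h' a' b' c') s"
    using lie_bracketI[OF LX LY] lie_bracketI[OF L L] X[OF s] Y[OF s] by simp
  then show ?thesis using lie_bracket_left_vec[OF s] by simp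
qed

text \<open>These are the rescaled structure constants of the algebra. For instance, [H, F - G] = 2
  (F + G) produces the coefficient \<open>1 / sqrt \<beta>\<close> of \<open>L 1\<close>.\<close>

lemma lie_bracket_frame:
  fixes \<alpha> \<beta> \<gamma> \<delta> :: real
  assumes pos: "\<alpha> > 0" "\<beta> > 0" "\<gamma> > 0" "\<delta> > 0" and s: "s \<in> S_domain"
  defines "L \<equiv> frame \<alpha> \<beta> \<gamma> \<delta>"
  shows "lie_bracket (L 1) (L 2) s = - (sqrt \<beta> / \<alpha>) *\<^sub>R L 3 s"
    "lie_bracket (L 2) (L 3) s = (1 / sqrt \<beta>) *\<^sub>R L 1 s"
    "lie_bracket (L 3) (L 1) s = (1 / sqrt \<beta>) *\<^sub>R L 2 s"
    "lie_bracket (L 1) (L 4) s = - (1 / (2 * sqrt \<alpha>)) *\<^sub>R L 5 s"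
    "lie_bracket (L 1) (L 5) s = - (1 / (2 * sqrt \<alpha>)) *\<^sub>R L 4 s"
    "lie_bracket (L 1) (L 6) s = 0"
    "lie_bracket (L 2) (L 4) s = - (1 / (2 * sqrt \<alpha>)) *\<^sub>R L 4 s"
    "lie_bracket (L 2) (L 5) s = (1 / (2 * sqrt \<alpha>)) *\<^sub>R L 5 s"
    "lie_bracket (L 2) (L 6) s = 0"
    "lie_bracket (L 3) (L 4) s = - (1 / (2 * sqrt \<beta>)) *\<^sub>R L 5 s"
    "lie_bracket (L 3) (L 5) s = (1 / (2 * sqrt \<beta>)) *\<^sub>R L 4 s"
    "lie_bracket (L 3) (L 6) s = 0"
    "lie_bracket (L 4) (L 5) s = (2 * sqrt \<delta> / \<gamma>) *\<^sub>R L 6 s"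
    "lie_bracket (L 4) (L 6) s = 0"
    "lie_bracket (L 5) (L 6) s = 0"
proof -
  note br = lie_bracket_eq_left_vec[OF s frame_eq_left_vec(1) frame_eq_left_vec(2)]
    lie_bracket_eq_left_vec[OF s frame_eq_left_vec(2) frame_eq_left_vec(3)]
    lie_bracket_eq_left_vec[OF s frame_eq_left_vec(3) frame_eq_left_vec(1)]
    lie_bracket_eq_left_vec[OF s frame_eq_left_vec(1) frame_eq_left_vec(4)]
    lie_bracket_eq_left_vec[OF s frame_eq_left_vec(1) frame_eq_left_vec(5)]
    lie_bracket_eq_left_vec[OF s frame_eq_left_vec(1) frame_eq_left_vec(6)]
    lie_bracket_eq_left_vec[OF s frame_eq_left_vec(2) frame_eq_left_vec(4)]
    lie_bracket_eq_left_vec[OF s frame_eq_left_vec(2) frame_eq_left_vec(5)]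
    lie_bracket_eq_left_vec[OF s frame_eq_left_vec(2) frame_eq_left_vec(6)]
    lie_bracket_eq_left_vec[OF s frame_eq_left_vec(3) frame_eq_left_vec(4)]
    lie_bracket_eq_left_vec[OF s frame_eq_left_vec(3) frame_eq_left_vec(5)]
    lie_bracket_eq_left_vec[OF s frame_eq_left_vec(3) frame_eq_left_vec(6)]
    lie_bracket_eq_left_vec[OF s frame_eq_left_vec(4) frame_eq_left_vec(5)]
    lie_bracket_eq_left_vec[OF s frame_eq_left_vec(4) frame_eq_left_vec(6)]
    lie_bracket_eq_left_vec[OF s frame_eq_left_vec(5) frame_eq_left_vec(6)]
  have zero: "left_vec 0 0 0 0 0 0 s = 0"
    by (simp add: left_vec_def vec_eq_iff forall_6)
  have sq: "sqrt \<alpha> * sqrt \<alpha> = \<alpha>" "sqrt \<beta> * sqrt \<beta> = \<beta>" "sqrt \<gamma> * sqrt \<gamma> = \<gamma>" "sqrt \<delta> * sqrt \<delta> = \<delta>"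
    using pos by simp_all
  have r: "sqrt \<alpha> \<noteq> 0" "sqrt \<beta> \<noteq> 0" "sqrt \<gamma> \<noteq> 0" "sqrt \<delta> \<noteq> 0" using pos by simp_all
  show "lie_bracket (L 1) (L 2) s = - (sqrt \<beta> / \<alpha>) *\<^sub>R L 3 s"
    "lie_bracket (L 2) (L 3) s = (1 / sqrt \<beta>) *\<^sub>R L 1 s"
    "lie_bracket (L 3) (L 1) s = (1 / sqrt \<beta>) *\<^sub>R L 2 s"
    "lie_bracket (L 1) (L 4) s = - (1 / (2 * sqrt \<alpha>)) *\<^sub>R L 5 s"
    "lie_bracket (L 1) (L 5) s = - (1 / (2 * sqrt \<alpha>)) *\<^sub>R L 4 s"
    "lie_bracket (L 1) (L 6) s = 0"
    "lie_bracket (L 2) (L 4) s = - (1 / (2 * sqrt \<alpha>)) *\<^sub>R L 4 s"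
    "lie_bracket (L 2) (L 5) s = (1 / (2 * sqrt \<alpha>)) *\<^sub>R L 5 s"
    "lie_bracket (L 2) (L 6) s = 0"
    "lie_bracket (L 3) (L 4) s = - (1 / (2 * sqrt \<beta>)) *\<^sub>R L 5 s"
    "lie_bracket (L 3) (L 5) s = (1 / (2 * sqrt \<beta>)) *\<^sub>R L 4 s"
    "lie_bracket (L 3) (L 6) s = 0"
    "lie_bracket (L 4) (L 5) s = (2 * sqrt \<delta> / \<gamma>) *\<^sub>R L 6 s"
    "lie_bracket (L 4) (L 6) s = 0"
    "lie_bracket (L 5) (L 6) s = 0"
    unfolding L_def frame_eq_left_vec[OF s] left_vec_linear
    using r pos by (simp_all add: br) (simp_all add: zero sq field_simps)
qed

section \<open>Fundamental vector fields\<close>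

lemma mat_exp_square_zero:
  fixes Z :: "real^'n^'n"
  assumes "Z ** Z = 0"
  shows "mat_exp (t *\<^sub>R Z) = mat 1 + t *\<^sub>R Z"
proof -
  have "(t *\<^sub>R Z) ** (t *\<^sub>R Z) = (t * t) *\<^sub>R (Z ** Z)"
    by (simp add: vec_eq_iff matrix_matrix_mult_def sum_distrib_left algebra_simps)
  then have sq: "(t *\<^sub>R Z) ** (t *\<^sub>R Z) = 0" using assms by simp
  have "mat_power (t *\<^sub>R Z) n = 0" if n: "n \<notin> {0, 1}" for n
  proof -
    obtain m where "n = Suc (Suc m)" using n by (cases n; cases "n - 1") auto
    then show ?thesis using sq by (simp add: matrix_mul_assoc)
  qed
  then have "mat_exp (t *\<^sub>R Z) = (\<Sum>n\<in>{0, 1}. (1 / fact n) *\<^sub>R mat_power (t *\<^sub>R Z) n)"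
    unfolding mat_exp_def by (intro suminf_finite) auto
  then show ?thesis by simp
qed

lemma mat_power_diagonal:
  "mat_power (\<chi> i j. if i = j then c i else 0 :: real^'n^'n) n = (\<chi> i j. if i = j then c i ^ n else 0)"
  by (induction n) (simp_all add: mat_def vec_eq_iff matrix_matrix_mult_def if_distrib[of "\<lambda>x. x * _"]
    if_distrib[of "\<lambda>x. _ * x"] cong: if_cong)

text \<open>Serves the generator H, which is diagonal but not nilpotent. Each diagonal entry is a
  scalar exponential series.\<close>

lemma mat_exp_diagonal:
  "mat_exp (\<chi> i j. if i = j then c i else 0 :: real^'n^'n) = (\<chi> i j. if i = j then exp (c i) else 0)"
proof -
  have "(\<lambda>n. (1 / fact n) *\<^sub>R (\<chi> i j. if i = j then c i ^ n else 0 :: real^'n^'n)) sums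
    (\<chi> i j. if i = j then exp (c i) else 0)"
    unfolding sums_def
  proof (intro vec_tendstoI)
    fix i j
    have "(\<lambda>n. \<Sum>k<n. c i ^ k /\<^sub>R fact k) \<longlonglongrightarrow> exp (c i)"
      using exp_converges[of "c i"] by (simp add: sums_def)
    then show "(\<lambda>n. (\<Sum>k<n. (1 / fact k) *\<^sub>R (\<chi> i j. if i = j then c i ^ k else 0 :: real^'n^'n)) $ i $ j)
      \<longlonglongrightarrow> (\<chi> i j. if i = j then exp (c i) else 0) $ i $ j"
      by (cases "i = j") (simp_all add: divide_inverse mult.commute)
  qed
  then show ?thesis
    unfolding mat_exp_def mat_power_diagonal by (rule sums_unique[symmetric])
qed

text \<open>H has a diagonal exponential; the other five generators square to zero, so their
  exponentials are affine in t.\<close>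

lemma has_derivative_mat_exp_gen:
  assumes "Z \<in> {gen_F, gen_G, gen_H, gen_P, gen_Q, gen_R}"
  shows "((\<lambda>t. mat_exp (t *\<^sub>R Z)) has_derivative (\<lambda>t. t *\<^sub>R Z)) (at 0)"
proof (cases "Z = gen_H")
  case False
  moreover have "\<forall>Z\<in>{gen_F, gen_G, gen_P, gen_Q, gen_R}. Z ** Z = 0"
    by (simp add: gen_eq_algebra_element algebra_element_def vec_eq_iff forall_4
        matrix_matrix_mult_def sum_4)
  ultimately have "Z ** Z = 0" using assms by blast
  then show ?thesis
    by (simp add: mat_exp_square_zero) (auto intro!: derivative_eq_intros)
next
  case True
  define e :: "real^4" where "e = vector [1, 0, -1, 0]"
  have Z: "t *\<^sub>R Z = (\<chi> i j. if i = j then t * e $ i else 0)" for t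
    unfolding True by (simp add: e_def gen_eq_algebra_element algebra_element_def vec_eq_iff forall_4)
  show ?thesis
    unfolding Z mat_exp_diagonal
  proof (rule has_derivative_matrixI)
    fix i j
    show "((\<lambda>t. (\<chi> i j. if i = j then exp (t * e $ i) else 0 :: real^4^4) $ i $ j) has_derivative
      (\<lambda>t. (\<chi> i j. if i = j then t * e $ i else 0) $ i $ j)) (at 0)"
      by (cases "i = j") (auto intro!: derivative_eq_intros)
  qed
qed

lemma vector_derivative_mat_exp_gen:
  assumes "Z \<in> {gen_F, gen_G, gen_H, gen_P, gen_Q, gen_R}"
  shows "vector_derivative (\<lambda>t. mat_exp (t *\<^sub>R Z) ** g) (at 0) = Z ** g"
proof (rule vector_derivative_at)
  have "linear (\<lambda>A :: real^4^4. A ** g)"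
    by (rule linearI) (simp_all add: vec_eq_iff forall_4 matrix_matrix_mult_def sum_4 algebra_simps)
  then have "bounded_linear (\<lambda>A :: real^4^4. A ** g)" by (simp add: linear_conv_bounded_linear)
  from bounded_linear.has_derivative[OF this has_derivative_mat_exp_gen[OF assms]]
  have "((\<lambda>t. mat_exp (t *\<^sub>R Z) ** g) has_derivative (\<lambda>t. (t *\<^sub>R Z) ** g)) (at 0)" .
  moreover have "(t *\<^sub>R Z) ** g = t *\<^sub>R (Z ** g)" for t
    by (simp add: vec_eq_iff forall_4 matrix_matrix_mult_def sum_4 algebra_simps)
  ultimately show "((\<lambda>t. mat_exp (t *\<^sub>R Z) ** g) has_vector_derivative Z ** g) (at 0)"
    by (simp add: has_vector_derivative_def)
qed

text \<open>The solution \<open>v\<close> of \<^term>\<open>S_matrix s ** maurer_cartan s v = algebra_element f g h a b c ** S_matrix s\<close>.\<close>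

definition fundamental_vec ::
  "real \<Rightarrow> real \<Rightarrow> real \<Rightarrow> real \<Rightarrow> real \<Rightarrow> real \<Rightarrow> real^6 \<Rightarrow> real^6" where
  "fundamental_vec f g h a b c s = vector
     [f + g * ((s$2)\<^sup>2 - (s$1)\<^sup>2) + 2 * h * s$1, 2 * h * s$2 - 2 * g * s$1 * s$2, - g * s$2,
      a - h * s$4 - g * s$5, b - f * s$4 + h * s$5, c + a * s$5 - b * s$4]"

lemma algebra_element_mult_S_matrix:
  assumes s: "s \<in> S_domain"
  shows "algebra_element f g h a b c ** S_matrix s =
    S_matrix s ** maurer_cartan s (fundamental_vec f g h a b c s)"
proof -
  have "s$2 > 0" using assms by (simp add: S_domain_def)
  then obtain r where r: "r > 0" "s$2 = r * r" "sqrt (s$2) = r" by (rule sqrt_param)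
  define k where "k = inverse r"
  have rk: "r * k = 1" using r(1) by (simp add: k_def)
  define C D where "C = cos (s$3)" and "D = sin (s$3)"
  have cs: "D * D = 1 - C * C"
    by (simp add: C_def D_def power2_eq_square[symmetric] sin_squared_eq)
  define hh :: real where hh: "hh = inverse 2"
  have h2: "2 * hh = 1" by (simp add: hh)
  let ?M = "sl2_part s" and ?v = "fundamental_vec f g h a b c s"
  have det: "?M $ 1 $ 1 * ?M $ 2 $ 2 = 1 + ?M $ 1 $ 2 * ?M $ 2 $ 1"
    using det_sl2_part[OF s] by simp
  \<comment> \<open>The four entries of M w = z M, where w and z are the 2x2 blocks of \<omega>(v)
    and of the given algebra element. The remaining entries then need only these and det M =
    1.\<close>
  have e: "?M $ 1 $ 1 * mc_H s ?v + ?M $ 1 $ 2 * mc_G s ?v = h * ?M $ 1 $ 1 + f * ?M $ 2 $ 1"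
    "?M $ 1 $ 1 * mc_F s ?v - ?M $ 1 $ 2 * mc_H s ?v = h * ?M $ 1 $ 2 + f * ?M $ 2 $ 2"
    "?M $ 2 $ 1 * mc_H s ?v + ?M $ 2 $ 2 * mc_G s ?v = g * ?M $ 1 $ 1 - h * ?M $ 2 $ 1"
    "?M $ 2 $ 1 * mc_F s ?v - ?M $ 2 $ 2 * mc_H s ?v = g * ?M $ 1 $ 2 - h * ?M $ 2 $ 2"
    unfolding sl2_part_def iwasawa_entries vector_2 r(3) mc_F_def mc_G_def mc_H_def C_def[symmetric] D_def[symmetric]
      fundamental_vec_def vector_6
    unfolding r(2) divide_inverse inverse_mult_distrib k_def[symmetric] hh[symmetric] power2_eq_square
    using rk cs h2 by algebra+
  have v: "?v $ 4 = a - h * s$4 - g * s$5" "?v $ 5 = b - f * s$4 + h * s$5" "?v $ 6 = c + a * s$5 - b * s$4"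
    by (simp_all add: fundamental_vec_def)
  \<comment> \<open>From here on the three coefficients are opaque; all that matters about them is
    contained in \<open>e\<close>.\<close>
  define F' where "F' = mc_F s ?v"
  define G' where "G' = mc_G s ?v"
  define H' where "H' = mc_H s ?v"
  note e = e[folded F'_def G'_def H'_def]
  show ?thesis
    unfolding vec_eq_iff forall_4 matrix_matrix_mult_def sum_4 S_matrix_def maurer_cartan_def algebra_element_def
      Let_def mc_P_def mc_Q_def mc_R_def v F'_def[symmetric] G'_def[symmetric] H'_def[symmetric]
    apply simp
    apply (intro conjI)
    apply (use e det in algebra)+
    done
qed

text \<open>The coefficients are restricted to those of the generators because the exponential was
  differentiated for these.\<close>

lemma fundamental_field_eq:
  assumes s: "s \<in> S_domain" and Z: "algebra_element f g h a b c \<in> {gen_F, gen_G, gen_H, gen_P, gen_Q, gen_R}"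
  shows "fundamental_field (algebra_element f g h a b c) s = fundamental_vec f g h a b c s"
  unfolding fundamental_field_def vector_derivative_mat_exp_gen[OF Z]
  by (rule S_field_eqI[OF s]) (simp add: S_param_eq_S_matrix[OF s] algebra_element_mult_S_matrix[OF s])

section \<open>The Killing equations\<close>

text \<open>The derivative of \<^term>\<open>\<lambda>s. S_form \<alpha> \<beta> \<gamma> \<delta> s v w\<close> in the direction \<open>z\<close>.\<close>

definition S_form_deriv ::
  "real \<Rightarrow> real \<Rightarrow> real \<Rightarrow> real \<Rightarrow> real^6 \<Rightarrow> real^6 \<Rightarrow> real^6 \<Rightarrow> real^6 \<Rightarrow> real" where
  "S_form_deriv \<alpha> \<beta> \<gamma> \<delta> s z v w =
     - (2 * \<alpha> * z$2 * ((v$1 * w$1 + v$2 * w$2) / (s$2)^3))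
       - \<beta> * z$2 / (s$2)\<^sup>2 * (v$1 * (w$1 / s$2 + 2 * w$3) + (v$1 / s$2 + 2 * v$3) * w$1)
       - \<gamma> * z$2 / (s$2)\<^sup>2 *
           (v$5 * w$5 + ((s$1)\<^sup>2 + (s$2)\<^sup>2) * (v$4 * w$4) + s$1 * (v$4 * w$5 + v$5 * w$4))
       + \<gamma> / s$2 * ((2 * s$1 * z$1 + 2 * s$2 * z$2) * (v$4 * w$4) + z$1 * (v$4 * w$5 + v$5 * w$4))
       + \<delta> * ((z$5 * v$4 - z$4 * v$5) * (w$6 - s$4 * w$5 + s$5 * w$4)
           + (v$6 - s$4 * v$5 + s$5 * v$4) * (z$5 * w$4 - z$4 * w$5))"

lemma S_form_linear:
  "S_form \<alpha> \<beta> \<gamma> \<delta> s (v + v') w = S_form \<alpha> \<beta> \<gamma> \<delta> s v w + S_form \<alpha> \<beta> \<gamma> \<delta> s v' w"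
  "S_form \<alpha> \<beta> \<gamma> \<delta> s (v - v') w = S_form \<alpha> \<beta> \<gamma> \<delta> s v w - S_form \<alpha> \<beta> \<gamma> \<delta> s v' w"
  "S_form \<alpha> \<beta> \<gamma> \<delta> s (r *\<^sub>R v) w = r * S_form \<alpha> \<beta> \<gamma> \<delta> s v w"
  by (simp_all add: S_form_def add_divide_distrib diff_divide_distrib algebra_simps)

lemma S_form_commute: "S_form \<alpha> \<beta> \<gamma> \<delta> s v w = S_form \<alpha> \<beta> \<gamma> \<delta> s w v"
  by (simp add: S_form_def algebra_simps)

lemma S_form_deriv_linear:
  "S_form_deriv \<alpha> \<beta> \<gamma> \<delta> s z (v + v') w = S_form_deriv \<alpha> \<beta> \<gamma> \<delta> s z v w + S_form_deriv \<alpha> \<beta> \<gamma> \<delta> s z v' w"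
  "S_form_deriv \<alpha> \<beta> \<gamma> \<delta> s z (r *\<^sub>R v) w = r * S_form_deriv \<alpha> \<beta> \<gamma> \<delta> s z v w"
  by (simp_all add: S_form_deriv_def add_divide_distrib diff_divide_distrib algebra_simps)

lemma S_form_deriv_commute: "S_form_deriv \<alpha> \<beta> \<gamma> \<delta> s z v w = S_form_deriv \<alpha> \<beta> \<gamma> \<delta> s z w v"
  by (simp add: S_form_deriv_def algebra_simps)

text \<open>The product rule: one term for the coefficients of the metric and one for each vector
  field.\<close>

lemma has_derivative_S_form:
  assumes s: "s \<in> S_domain" and V: "(V has_derivative V') (at s)" and W: "(W has_derivative W') (at s)"
  shows "((\<lambda>u. S_form \<alpha> \<beta> \<gamma> \<delta> u (V u) (W u)) has_derivative
    (\<lambda>z. S_form_deriv \<alpha> \<beta> \<gamma> \<delta> s z (V s) (W s)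
      + S_form \<alpha> \<beta> \<gamma> \<delta> s (V' z) (W s) + S_form \<alpha> \<beta> \<gamma> \<delta> s (V s) (W' z))) (at s)"
proof -
  have y: "s$2 \<noteq> 0" "(s$2)\<^sup>2 \<noteq> 0" using s by (simp_all add: S_domain_def)
  note rules = has_derivative_add has_derivative_diff has_derivative_mult has_derivative_divide' y
    has_derivative_const has_derivative_vec_nth[OF has_derivative_ident[where 'a = "real^6"]]
    has_derivative_vec_nth[OF V] has_derivative_vec_nth[OF W]
  define k where "k = inverse (s$2)"
  have yk: "s$2 * k = 1" using y by (simp add: k_def)
  show ?thesis
    unfolding S_form_def power2_eq_square
    apply (rule has_derivative_eq_rhs, (rule rules[unfolded power2_eq_square])+)
    apply (rule ext)
    unfolding S_form_deriv_def S_form_def divide_inverse inverse_mult_distrib power2_eq_square power3_eq_cube k_def[symmetric]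
    using yk by algebra
qed

text \<open>The Lie derivative of the metric at \<open>s\<close> along a field with value \<open>z\<close> and derivative \<open>A\<close> there.\<close>

definition lie_form ::
  "real \<Rightarrow> real \<Rightarrow> real \<Rightarrow> real \<Rightarrow> real^6 \<Rightarrow> real^6 \<Rightarrow> (real^6 \<Rightarrow> real^6) \<Rightarrow> real^6 \<Rightarrow> real^6 \<Rightarrow> real" where
  "lie_form \<alpha> \<beta> \<gamma> \<delta> s z A v w =
     S_form_deriv \<alpha> \<beta> \<gamma> \<delta> s z v w + S_form \<alpha> \<beta> \<gamma> \<delta> s (A v) w + S_form \<alpha> \<beta> \<gamma> \<delta> s v (A w)"

text \<open>The terms with V' and W' from the product rule cancel against those in the two brackets.
  What remains depends on V and W only through their values at s.\<close>

lemma lie_derivative_S_metric: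
  assumes pos: "\<alpha> \<ge> 0" "\<beta> \<ge> 0" "\<gamma> \<ge> 0" "\<delta> \<ge> 0" and s: "s \<in> S_domain"
    and X: "(X has_derivative X') (at s)" and V: "(V has_derivative V') (at s)" and W: "(W has_derivative W') (at s)"
  shows "lie_derivative X (S_metric \<alpha> \<beta> \<gamma> \<delta>) V W s = lie_form \<alpha> \<beta> \<gamma> \<delta> s (X s) X' (V s) (W s)"
proof -
  have "((\<lambda>u. S_metric \<alpha> \<beta> \<gamma> \<delta> u (V u) (W u)) has_derivative
    (\<lambda>z. S_form_deriv \<alpha> \<beta> \<gamma> \<delta> s z (V s) (W s)
      + S_form \<alpha> \<beta> \<gamma> \<delta> s (V' z) (W s) + S_form \<alpha> \<beta> \<gamma> \<delta> s (V s) (W' z))) (at s)"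
    by (rule has_derivative_transform_within_open[OF has_derivative_S_form[OF s V W] open_S_domain s])
      (simp add: S_metric_eq_S_form[OF pos])
  from fun_cong[OF frechet_derivative_at[OF this, symmetric], of "X s"]
  show ?thesis
    by (simp add: lie_derivative_def lie_bracketI[OF X V] lie_bracketI[OF X W] S_metric_eq_S_form[OF pos s]
      lie_form_def S_form_commute[of _ _ _ _ s "V s"] S_form_linear)
qed

lemma lie_form_commute: "lie_form \<alpha> \<beta> \<gamma> \<delta> s z A v w = lie_form \<alpha> \<beta> \<gamma> \<delta> s z A w v"
  unfolding lie_form_def by (metis S_form_commute S_form_deriv_commute add.assoc add.commute)

text \<open>Linearity of A gives linearity in the first argument, symmetry gives it in the second,
  and a bilinear form is determined on the standard basis.\<close>

lemma lie_form_eq_0_iff: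
  assumes A: "linear A"
  shows "(\<forall>v w. lie_form \<alpha> \<beta> \<gamma> \<delta> s z A v w = 0) \<longleftrightarrow>
    (\<forall>i j. lie_form \<alpha> \<beta> \<gamma> \<delta> s z A (axis i 1) (axis j 1) = 0)"
proof
  assume *: "\<forall>i j. lie_form \<alpha> \<beta> \<gamma> \<delta> s z A (axis i 1) (axis j 1) = 0"
  let ?K = "lie_form \<alpha> \<beta> \<gamma> \<delta> s z A"
  have lin: "linear (\<lambda>v. ?K v w)" for w
    by (rule linearI) (simp_all add: lie_form_def S_form_linear S_form_deriv_linear
        linear_add[OF A] linear_scale[OF A] algebra_simps)
  have "linear (\<lambda>v. ?K w v)" for w
    using lin[of w] by (simp add: lie_form_commute[of _ _ _ _ _ _ _ w])
  with lin have bl: "bilinear ?K" unfolding bilinear_def by blast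
  have "bilinear (\<lambda>v w :: real^6. 0 :: real)" unfolding bilinear_def by (simp add: linear_zero)
  from bilinear_eq_stdbasis[OF bl this] have "?K = (\<lambda>v w. 0)"
    using * by (auto simp: Basis_vec_def)
  then show "\<forall>v w. ?K v w = 0" by metis
qed blast

section \<open>Coordinate form of the Killing condition\<close>

lemma partial_eq:
  assumes "(X has_derivative X') (at s)"
  shows "partial i (\<lambda>u. X u $ k) s = X' (axis i 1) $ k"
proof -
  \<comment> \<open>The chain rule along the line through s in the i-th coordinate
    direction.\<close>
  have "((\<lambda>t. X (s + t *\<^sub>R axis i 1) $ k) has_derivative (\<lambda>t. X' (t *\<^sub>R axis i 1) $ k)) (at 0)"
  proof (rule has_derivative_vec_nth)
    have *: "((\<lambda>t. s + t *\<^sub>R axis i 1) has_derivative (\<lambda>t. t *\<^sub>R axis i 1)) (at (0::real))"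
      by (auto intro!: derivative_eq_intros)
    show "((\<lambda>t. X (s + t *\<^sub>R axis i 1)) has_derivative (\<lambda>t. X' (t *\<^sub>R axis i 1))) (at 0)"
      using has_derivative_compose[OF *, of X X'] assms by simp
  qed
  moreover have "X' (t *\<^sub>R axis i 1) $ k = X' (axis i 1) $ k * t" for t
    by (simp add: linear_scale[OF has_derivative_linear[OF assms]])
  ultimately have "((\<lambda>t. X (s + t *\<^sub>R axis i 1) $ k) has_field_derivative X' (axis i 1) $ k) (at 0)"
    unfolding has_field_derivative_def by (simp add: fun_eq_iff)
  then show ?thesis unfolding partial_def by (rule DERIV_imp_deriv)
qed

lemma killing_equations_iff_lie_form:
  assumes pos: "\<alpha> > 0" "\<beta> > 0" "\<gamma> > 0" "\<delta> > 0" and s: "s \<in> S_domain"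
    and X: "(X has_derivative X') (at s)"
  shows "killing_equations \<alpha> \<beta> \<gamma> \<delta> X s \<longleftrightarrow>
    (\<forall>i j. lie_form \<alpha> \<beta> \<gamma> \<delta> s (X s) X' (axis i 1) (axis j 1) = 0)"
proof -
  let ?K = "\<lambda>i j. lie_form \<alpha> \<beta> \<gamma> \<delta> s (X s) X' (axis i 1) (axis j 1)"
  have comm: "?K i j = ?K j i" for i j by (rule lie_form_commute)
  \<comment> \<open>By symmetry the 21 components on and above the diagonal suffice, listed in the
    order of \<open>killing_equations\<close>.\<close>
  have upper: "(\<forall>i j. ?K i j = 0) \<longleftrightarrow>
      ?K 1 1 = 0 \<and> ?K 1 2 = 0 \<and> ?K 1 3 = 0 \<and> ?K 1 4 = 0 \<and> ?K 1 5 = 0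
      \<and> ?K 1 6 = 0 \<and> ?K 2 2 = 0 \<and> ?K 2 3 = 0 \<and> ?K 2 4 = 0 \<and> ?K 2 5 =
      0 \<and> ?K 2 6 = 0 \<and> ?K 3 3 = 0 \<and> ?K 3 4 = 0 \<and> ?K 3 5 = 0 \<and> ?K 3 6
      = 0 \<and> ?K 4 4 = 0 \<and> ?K 4 5 = 0 \<and> ?K 4 6 = 0 \<and> ?K 5 5 = 0 \<and> ?K 5
      6 = 0 \<and> ?K 6 6 = 0"
    unfolding forall_6 comm[of 2 1] comm[of 3 1] comm[of 4 1] comm[of 5 1] comm[of 6 1] comm[of 3 2] comm[of 4 2]
      comm[of 5 2] comm[of 6 2] comm[of 4 3] comm[of 5 3] comm[of 6 3] comm[of 5 4] comm[of 6 4]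
      comm[of 6 5]
    by blast
  define y where "y = s$2"
  define k where "k = inverse y"
  have nz: "y \<noteq> 0" "\<alpha> \<noteq> 0" "\<beta> \<noteq> 0" "\<delta> \<noteq> 0" using pos s by (auto simp: S_domain_def y_def)
  have yk: "y * k = 1" using nz by (simp add: k_def)
  \<comment> \<open>The 36 entries of the Jacobian matrix of X become atoms, shared by the equations
    and the components.\<close>
  define d where "d = (\<lambda>i k. X' (axis i 1) $ k)"
  have partial: "partial i (\<lambda>u. X u $ k) s = d i k" and d: "X' (axis i 1) $ k = d i k" for i k
    by (simp_all add: partial_eq[OF X] d_def)
  \<comment> \<open>An equation and a component vanish together as soon as nonzero multiples of them
    agree.\<close>
  have iff: "e = 0 \<longleftrightarrow> m = 0" if "c * e = c' * m" "c \<noteq> 0" "c' \<noteq> 0" for c c' e m :: real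
    using that by (metis mult_eq_0_iff)
  have ax: "(axis i (1::real)) $ j = (if j = i then 1 else 0)" for i j :: 6 by (simp add: axis_def)
  show ?thesis
    unfolding upper killing_equations_def Let_def partial y_def[symmetric]
    \<comment> \<open>Pairs each equation with the component in the same position.\<close>
    apply (intro arg_cong2[of _ _ _ _ conj])
    \<comment> \<open>\<open>c\<close> and \<open>c'\<close> restore the factors that were cleared from the components of the Lie derivative.\<close>
    apply (rule_tac [21] c = "2 * \<delta>" and c' = 1 in iff)
    apply (rule_tac [13-20] c = 1 and c' = 1 in iff)
    apply (rule_tac [12] c = "4 * \<beta>" and c' = y in iff)
    apply (rule_tac [8-11] c = 1 and c' = 1 in iff)
    apply (rule_tac [7] c = "2 * \<alpha>" and c' = "y^3" in iff)
    apply (rule_tac [4-6] c = 1 and c' = 1 in iff)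
    apply (rule_tac [2-3] c = 1 and c' = "y\<^sup>2" in iff)
    apply (rule_tac [1] c = 2 and c' = "y^3" in iff)
    apply (simp_all only: lie_form_def S_form_def S_form_deriv_def d y_def[symmetric] ax)
    apply (simp_all add: nz)
    apply (simp_all only: divide_inverse inverse_mult_distrib power2_eq_square power3_eq_cube k_def[symmetric])
    apply (algebra | use yk in algebra)+
    done
qed

text \<open>\<open>lie_form\<close> mediates: the Killing property tests it on values of vector
  fields, the equations on the coordinate basis.\<close>

lemma killing_field_on_iff_killing_equations:
  assumes pos: "\<alpha> > 0" "\<beta> > 0" "\<gamma> > 0" "\<delta> > 0" and X: "X differentiable_on S_domain"
  shows "killing_field_on S_domain (S_metric \<alpha> \<beta> \<gamma> \<delta>) X \<longleftrightarrow>
    (\<forall>s\<in>S_domain. killing_equations \<alpha> \<beta> \<gamma> \<delta> X s)"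
proof -
  have nonneg: "\<alpha> \<ge> 0" "\<beta> \<ge> 0" "\<gamma> \<ge> 0" "\<delta> \<ge> 0" using pos by simp_all
  let ?D = "\<lambda>V s. frechet_derivative V (at s)"
  have D: "(V has_derivative ?D V s) (at s)" if "V differentiable_on S_domain" "s \<in> S_domain"
    for V :: "real^6 \<Rightarrow> real^6" and s
    using that by (metis differentiable_on_eq_differentiable_at open_S_domain frechet_derivative_works)
  have L: "lie_derivative X (S_metric \<alpha> \<beta> \<gamma> \<delta>) V W s = lie_form \<alpha> \<beta> \<gamma> \<delta> s (X s) (?D X s) (V s) (W s)"
    if "V differentiable_on S_domain" "W differentiable_on S_domain" "s \<in> S_domain" for V W s
    by (rule lie_derivative_S_metric[OF nonneg that(3) D[OF X that(3)] D[OF that(1,3)] D[OF that(2,3)]])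
  have K: "killing_equations \<alpha> \<beta> \<gamma> \<delta> X s \<longleftrightarrow> (\<forall>v w. lie_form \<alpha> \<beta> \<gamma> \<delta> s (X s) (?D X s) v w = 0)"
    if "s \<in> S_domain" for s
    using that killing_equations_iff_lie_form[OF pos that D[OF X that]]
      lie_form_eq_0_iff[OF has_derivative_linear[OF D[OF X that]]] by blast
  show ?thesis
  proof
    assume *: "killing_field_on S_domain (S_metric \<alpha> \<beta> \<gamma> \<delta>) X"
    have "lie_form \<alpha> \<beta> \<gamma> \<delta> s (X s) (?D X s) v w = 0" if "s \<in> S_domain" for s v w
      \<comment> \<open>Constant fields serve as test fields, since they take arbitrary prescribed
        values at s.\<close>
      using * L[of "\<lambda>_. v" "\<lambda>_. w" s] that by (simp add: killing_field_on_def)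
    then show "\<forall>s\<in>S_domain. killing_equations \<alpha> \<beta> \<gamma> \<delta> X s" using K by blast
  next
    assume "\<forall>s\<in>S_domain. killing_equations \<alpha> \<beta> \<gamma> \<delta> X s"
    then show "killing_field_on S_domain (S_metric \<alpha> \<beta> \<gamma> \<delta>) X"
      using K L X by (simp add: killing_field_on_def)
  qed
qed

section \<open>The fundamental fields as solutions\<close>

lemma has_derivative_fundamental_vec:
  "(fundamental_vec f g h a b c has_derivative (\<lambda>v. vector
     [2 * g * (s$2 * v$2 - s$1 * v$1) + 2 * h * v$1, 2 * h * v$2 - 2 * g * (s$1 * v$2 + s$2 * v$1), - g * v$2,
      - h * v$4 - g * v$5, h * v$5 - f * v$4, a * v$5 - b * v$4])) (at s)"
  (is "(_ has_derivative ?D) _")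
proof (rule has_derivative_vecI)
  note rules = has_derivative_add has_derivative_diff has_derivative_mult
    has_derivative_const has_derivative_vec_nth[OF has_derivative_ident[where 'a = "real^6"]]
  have "\<forall>i. ((\<lambda>s. fundamental_vec f g h a b c s $ i) has_derivative (\<lambda>v. ?D v $ i)) (at s)"
    unfolding fundamental_vec_def forall_6 vector_6 power2_eq_square
    by (intro conjI; rule has_derivative_eq_rhs, (rule rules)+, simp add: fun_eq_iff algebra_simps)
  then show "((\<lambda>s. fundamental_vec f g h a b c s $ i) has_derivative (\<lambda>v. ?D v $ i)) (at s)" for i
    by blast
qed

text \<open>The components are polynomials in the coordinates, so substitution leaves rational
  identities whose only denominators are powers of y.\<close>

lemma killing_equations_fundamental:
  assumes s: "s \<in> S_domain" and X: "\<And>u. u \<in> S_domain \<Longrightarrow> X u = fundamental_vec f g h a b c u"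
  shows "killing_equations \<alpha> \<beta> \<gamma> \<delta> X s"
proof -
  note D = has_derivative_transform_within_open[OF has_derivative_fundamental_vec open_S_domain s X[symmetric]]
  define y where "y = s$2"
  define k where "k = inverse y"
  have y: "y \<noteq> 0" using s by (auto simp: S_domain_def y_def)
  have yk: "y * k = 1" using y by (simp add: k_def)
  have ax: "(axis i (1::real)) $ j = (if j = i then 1 else 0)" for i j :: 6 by (simp add: axis_def)
  show ?thesis
    unfolding killing_equations_def Let_def
    apply (simp only: partial_eq[OF D] X[OF s] ax vector_6 y_def[symmetric])
    unfolding fundamental_vec_def vector_6 y_def[symmetric]
    apply simp
    apply (simp only: divide_inverse inverse_mult_distrib power2_eq_square k_def[symmetric])
    apply (intro conjI)
    apply (algebra | use yk in algebra)+
    done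
qed

lemma fundamental_field_killing:
  assumes "Z \<in> {gen_F, gen_G, gen_H, gen_P, gen_Q, gen_R}"
  shows "fundamental_field Z differentiable_on S_domain"
    and "s \<in> S_domain \<Longrightarrow> killing_equations \<alpha> \<beta> \<gamma> \<delta> (fundamental_field Z) s"
proof -
  obtain f g h a b c where Z: "Z = algebra_element f g h a b c"
    using assms by (auto simp: gen_eq_algebra_element)
  note X = fundamental_field_eq[OF _ assms[unfolded Z], folded Z]
  show "s \<in> S_domain \<Longrightarrow> killing_equations \<alpha> \<beta> \<gamma> \<delta> (fundamental_field Z) s"
    by (rule killing_equations_fundamental[OF _ X])
  show "fundamental_field Z differentiable_on S_domain"
    unfolding differentiable_on_eq_differentiable_at[OF open_S_domain] differentiable_def
    using has_derivative_transform_within_open[OF has_derivative_fundamental_vec open_S_domain _ X[symmetric]]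
    by blast
qed

text \<open>The equivalence for arbitrary differentiable X shows that the displayed system is the
  Killing system of this metric, beyond having the six fundamental fields as solutions.\<close>

theorem proposition5:
  fixes \<alpha> \<beta> \<gamma> \<delta> :: real
  assumes "\<alpha> > 0" and "\<beta> > 0" and "\<gamma> > 0" and "\<delta> > 0"
  shows
    "let L = frame \<alpha> \<beta> \<gamma> \<delta> in
     left_invariant_metric (jacobi_metric \<alpha> \<beta> \<gamma> \<delta>) \<and>
     (\<forall>x y \<theta> p q \<kappa> dx dy d\<theta> dp dq d\<kappa> :: real. y > 0 \<longrightarrow>
        (let s = vector [x, y, \<theta>, p, q, \<kappa>]; v = vector [dx, dy, d\<theta>, dp, dq, d\<kappa>] in
          S_metric \<alpha> \<beta> \<gamma> \<delta> s v v = (\<Sum>i\<in>UNIV. (S_coframe \<alpha> \<beta> \<gamma> \<delta> i s v)^2) \<and>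
          S_metric \<alpha> \<beta> \<gamma> \<delta> s v v =
            \<alpha> * ((dx^2 + dy^2) / y^2) + \<beta> * (dx / y + 2 * d\<theta>)^2
            + \<gamma> / y * (dq^2 + (x^2 + y^2) * dp^2 + 2 * x * dp * dq)
            + \<delta> * (d\<kappa> - p * dq + q * dp)^2)) \<and>
     (\<forall>s\<in>S_domain. \<forall>i j.
        S_coframe \<alpha> \<beta> \<gamma> \<delta> i s (L j s) = (if i = j then 1 else 0) \<and>
        S_metric \<alpha> \<beta> \<gamma> \<delta> s (L i s) (L j s) = (if i = j then 1 else 0)) \<and>
     (\<forall>s\<in>S_domain.
        lie_bracket (L 1) (L 2) s = - (sqrt \<beta> / \<alpha>) *\<^sub>R L 3 s \<and>
        lie_bracket (L 2) (L 3) s = (1 / sqrt \<beta>) *\<^sub>R L 1 s \<and>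
        lie_bracket (L 3) (L 1) s = (1 / sqrt \<beta>) *\<^sub>R L 2 s \<and>
        lie_bracket (L 1) (L 4) s = - (1 / (2 * sqrt \<alpha>)) *\<^sub>R L 5 s \<and>
        lie_bracket (L 1) (L 5) s = - (1 / (2 * sqrt \<alpha>)) *\<^sub>R L 4 s \<and>
        lie_bracket (L 1) (L 6) s = 0 \<and>
        lie_bracket (L 2) (L 4) s = - (1 / (2 * sqrt \<alpha>)) *\<^sub>R L 4 s \<and>
        lie_bracket (L 2) (L 5) s = (1 / (2 * sqrt \<alpha>)) *\<^sub>R L 5 s \<and>
        lie_bracket (L 2) (L 6) s = 0 \<and>
        lie_bracket (L 3) (L 4) s = - (1 / (2 * sqrt \<beta>)) *\<^sub>R L 5 s \<and>
        lie_bracket (L 3) (L 5) s = (1 / (2 * sqrt \<beta>)) *\<^sub>R L 4 s \<and>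
        lie_bracket (L 3) (L 6) s = 0 \<and>
        lie_bracket (L 4) (L 5) s = (2 * sqrt \<delta> / \<gamma>) *\<^sub>R L 6 s \<and>
        lie_bracket (L 4) (L 6) s = 0 \<and>
        lie_bracket (L 5) (L 6) s = 0) \<and>
     (\<forall>x y \<theta> p q \<kappa> :: real. y > 0 \<longrightarrow>
        (let s = vector [x, y, \<theta>, p, q, \<kappa>] in
          fundamental_field gen_F s = vector [1, 0, 0, 0, - p, 0] \<and>
          fundamental_field gen_G s = vector [y^2 - x^2, - 2 * x * y, - y, - q, 0, 0] \<and>
          fundamental_field gen_H s = vector [2 * x, 2 * y, 0, - p, q, 0] \<and>
          fundamental_field gen_P s = vector [0, 0, 0, 1, 0, q] \<and>
          fundamental_field gen_Q s = vector [0, 0, 0, 0, 1, - p] \<and>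
          fundamental_field gen_R s = vector [0, 0, 0, 0, 0, 1])) \<and>
     (\<forall>X. X differentiable_on S_domain \<longrightarrow>
        (killing_field_on S_domain (S_metric \<alpha> \<beta> \<gamma> \<delta>) X \<longleftrightarrow>
          (\<forall>s\<in>S_domain. killing_equations \<alpha> \<beta> \<gamma> \<delta> X s))) \<and>
     (\<forall>Z\<in>{gen_F, gen_G, gen_H, gen_P, gen_Q, gen_R}.
        killing_field_on S_domain (S_metric \<alpha> \<beta> \<gamma> \<delta>) (fundamental_field Z) \<and>
        (\<forall>s\<in>S_domain. killing_equations \<alpha> \<beta> \<gamma> \<delta> (fundamental_field Z) s))"
proof -
  have nonneg: "\<alpha> \<ge> 0" "\<beta> \<ge> 0" "\<gamma> \<ge> 0" "\<delta> \<ge> 0" using assms by simp_all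
  have dom: "vector [x, y, \<theta>, p, q, \<kappa>] \<in> S_domain" if "y > 0" for x y \<theta> p q \<kappa> :: real
    using that by (simp add: S_domain_def)
  have metric: "let s = vector [x, y, \<theta>, p, q, \<kappa>]; v = vector [dx, dy, d\<theta>, dp, dq, d\<kappa>] in
      S_metric \<alpha> \<beta> \<gamma> \<delta> s v v = (\<Sum>i\<in>UNIV. (S_coframe \<alpha> \<beta> \<gamma> \<delta> i s v)^2) \<and>
      S_metric \<alpha> \<beta> \<gamma> \<delta> s v v =
        \<alpha> * ((dx^2 + dy^2) / y^2) + \<beta> * (dx / y + 2 * d\<theta>)^2
        + \<gamma> / y * (dq^2 + (x^2 + y^2) * dp^2 + 2 * x * dp * dq)
        + \<delta> * (d\<kappa> - p * dq + q * dp)^2"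
    if "y > 0" for x y \<theta> p q \<kappa> dx dy d\<theta> dp dq d\<kappa> :: real
    unfolding Let_def
  proof
    let ?s = "vector [x, y, \<theta>, p, q, \<kappa>] :: real^6" and ?v = "vector [dx, dy, d\<theta>, dp, dq, d\<kappa>] :: real^6"
    show "S_metric \<alpha> \<beta> \<gamma> \<delta> ?s ?v ?v = (\<Sum>i\<in>UNIV. (S_coframe \<alpha> \<beta> \<gamma> \<delta> i ?s ?v)^2)"
      by (simp add: S_metric_eq_sum power2_eq_square)
    show "S_metric \<alpha> \<beta> \<gamma> \<delta> ?s ?v ?v =
        \<alpha> * ((dx^2 + dy^2) / y^2) + \<beta> * (dx / y + 2 * d\<theta>)^2
        + \<gamma> / y * (dq^2 + (x^2 + y^2) * dp^2 + 2 * x * dp * dq)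
        + \<delta> * (d\<kappa> - p * dq + q * dp)^2"
      unfolding S_metric_eq_S_form[OF nonneg dom[OF that]] S_form_def vector_6 power2_eq_square
      by (simp add: algebra_simps)
  qed
  have fundamental: "let s = vector [x, y, \<theta>, p, q, \<kappa>] in
      fundamental_field gen_F s = vector [1, 0, 0, 0, - p, 0] \<and>
      fundamental_field gen_G s = vector [y^2 - x^2, - 2 * x * y, - y, - q, 0, 0] \<and>
      fundamental_field gen_H s = vector [2 * x, 2 * y, 0, - p, q, 0] \<and>
      fundamental_field gen_P s = vector [0, 0, 0, 1, 0, q] \<and>
      fundamental_field gen_Q s = vector [0, 0, 0, 0, 1, - p] \<and>
      fundamental_field gen_R s = vector [0, 0, 0, 0, 0, 1]"
    if "y > 0" for x y \<theta> p q \<kappa> :: real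
    unfolding Let_def gen_eq_algebra_element
    using fundamental_field_eq[OF dom[OF that]]
    by (simp add: gen_eq_algebra_element fundamental_vec_def)
  have killing: "\<forall>X. X differentiable_on S_domain \<longrightarrow>
      (killing_field_on S_domain (S_metric \<alpha> \<beta> \<gamma> \<delta>) X \<longleftrightarrow>
        (\<forall>s\<in>S_domain. killing_equations \<alpha> \<beta> \<gamma> \<delta> X s))"
    using killing_field_on_iff_killing_equations[OF assms] by blast
  moreover have "\<forall>Z\<in>{gen_F, gen_G, gen_H, gen_P, gen_Q, gen_R}.
      killing_field_on S_domain (S_metric \<alpha> \<beta> \<gamma> \<delta>) (fundamental_field Z) \<and>
      (\<forall>s\<in>S_domain. killing_equations \<alpha> \<beta> \<gamma> \<delta> (fundamental_field Z) s)"
  proof (intro ballI conjI)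
    fix Z assume Z: "Z \<in> {gen_F, gen_G, gen_H, gen_P, gen_Q, gen_R}"
    show "killing_equations \<alpha> \<beta> \<gamma> \<delta> (fundamental_field Z) s" if "s \<in> S_domain" for s
      by (rule fundamental_field_killing(2)[OF Z that])
    \<comment> \<open>The equations, once verified, give the Killing property through the
      equivalence.\<close>
    then show "killing_field_on S_domain (S_metric \<alpha> \<beta> \<gamma> \<delta>) (fundamental_field Z)"
      using killing fundamental_field_killing(1)[OF Z] by blast
  qed
  moreover have "\<forall>s\<in>S_domain. \<forall>i j.
      S_coframe \<alpha> \<beta> \<gamma> \<delta> i s (frame \<alpha> \<beta> \<gamma> \<delta> j s) = (if i = j then 1 else 0) \<and>
      S_metric \<alpha> \<beta> \<gamma> \<delta> s (frame \<alpha> \<beta> \<gamma> \<delta> i s) (frame \<alpha> \<beta> \<gamma> \<delta> j s) = (if i = j then 1 else 0)"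
    using S_coframe_frame[OF assms] S_metric_frame[OF assms] by blast
  ultimately show ?thesis
    unfolding Let_def[of "frame \<alpha> \<beta> \<gamma> \<delta>"]
    apply (intro conjI)
          apply (rule left_invariant_jacobi_metric[OF assms])
         apply (intro allI impI, rule metric, assumption)
        apply assumption
       apply (intro ballI conjI lie_bracket_frame[OF assms]; assumption)
      apply (intro allI impI, rule fundamental, assumption)
     apply assumption
    apply assumption
    done
qed

end
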